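(* Let $T$ be a strongly dependent theory, let $G$ be a type definable group, and for each $i<\omega$ let $G_i\le G$ be a type definable normal subgroup of $G$. Then there is some $i_0<\omega$ such that $\left[\bigcap_{i\ne i_0}G_i:\bigcap_{i<\omega}G_i\right]<\infty$ (i.e. this index is bounded).
   Context: $T$ is a complete first order theory and $\mathfrak{C}$ is its monster model (a very big saturated model containing all small models). Type definable group: given by a partial type $\Sigma(x)$ ($x$ a finite tuple), possibly over a small set of parameters, and a formula $\nu(x,y,z)$ such that $\langle \Sigma(\mathfrak{C}),\nu\rangle$ is a group with $\nu$ defining the (graph of the) group operation. A subgroup relation $H\le G$ between type definable groups means $H(\mathfrak{C})$ is a subgroup of $G(\mathfrak{C})$ (with the same operation). Unbounded index: for type definable groups $H\le G$, the index $[G:H]$ is unbounded, written $[G:H]=\infty$, if for every cardinal $\kappa$ there is a model $M\models T$ (containing the parameters) with $[G^M:H^M]\ge\kappa$. Equivalently, there is in $\mathfrak{C}$ a sequence $\langle a_i\mid i<\omega\rangle$ of elements of $G$, indiscernible over the parameters defining $G$ and $H$, with $a_i\cdot a_j^{-1}\notin H$ for $i<j$. Otherwise the index is bounded, written $[G:H]<\infty$. Indiscernible array: $\langle a_{i,j}\mid i,j<\omega\rangle$ (tuples) is an indiscernible array over $A$ if for each $i_0<\omega$ the row $\langle a_{i_0,j}\mid j<\omega\rangle$ is indiscernible over $A\cup\{a_{i,j}\mid i\ne i_0,\ i,j<\omega\}$. Strongly dependent: $T$ is not strongly dependent if there are formulas $\langle\varphi_i(x,y_i)\mid i<\omega\rangle$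 ($x$ a fixed finite tuple of variables) and an array $\langle a_{i,j}\mid i,j<\omega\rangle$ which is an indiscernible array over $\emptyset$ such that the set $\{\varphi_i(x,a_{i,0})\wedge\neg\varphi_i(x,a_{i,1})\mid i<\omega\}$ is consistent. $T$ is strongly dependent if no such configuration exists. *)

theory Defs
  imports Main "HOL-Algebra.Coset"
begin

unbundle cardinal_syntax

section \<open>First-order logic\<close>

record ('f, 'r) lang =
  fsyms :: "'f set"
  rsyms :: "'r set"
  far :: "'f \<Rightarrow> nat"
  rar :: "'r \<Rightarrow> nat"

datatype 'f tm = Var nat | Fn 'f "'f tm list"

text \<open>Variables are de Bruijn indices; \<open>Ex\<close> binds index 0.\<close>

datatype ('f, 'r) fm =
    Eq "'f tm" "'f tm"
  | Rel 'r "'f tm list"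
  | Neg "('f, 'r) fm"
  | Conj "('f, 'r) fm" "('f, 'r) fm"
  | Ex "('f, 'r) fm"

fun wf_tm :: "('f, 'r) lang \<Rightarrow> 'f tm \<Rightarrow> bool" where
  "wf_tm L (Var v) \<longleftrightarrow> True"
| "wf_tm L (Fn f ts) \<longleftrightarrow> f \<in> fsyms L \<and> length ts = far L f \<and> (\<forall>t \<in> set ts. wf_tm L t)"

fun wf_fm :: "('f, 'r) lang \<Rightarrow> ('f, 'r) fm \<Rightarrow> bool" where
  "wf_fm L (Eq s t) \<longleftrightarrow> wf_tm L s \<and> wf_tm L t"
| "wf_fm L (Rel r ts) \<longleftrightarrow> r \<in> rsyms L \<and> length ts = rar L r \<and> (\<forall>t \<in> set ts. wf_tm L t)"
| "wf_fm L (Neg \<phi>) \<longleftrightarrow> wf_fm L \<phi>"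
| "wf_fm L (Conj \<phi> \<psi>) \<longleftrightarrow> wf_fm L \<phi> \<and> wf_fm L \<psi>"
| "wf_fm L (Ex \<phi>) \<longleftrightarrow> wf_fm L \<phi>"

fun fv_tm :: "'f tm \<Rightarrow> nat set" where
  "fv_tm (Var v) = {v}"
| "fv_tm (Fn f ts) = (\<Union>t \<in> set ts. fv_tm t)"

fun fv :: "('f, 'r) fm \<Rightarrow> nat set" where
  "fv (Eq s t) = fv_tm s \<union> fv_tm t"
| "fv (Rel r ts) = (\<Union>t \<in> set ts. fv_tm t)"
| "fv (Neg \<phi>) = fv \<phi>"
| "fv (Conj \<phi> \<psi>) = fv \<phi> \<union> fv \<psi>"
| "fv (Ex \<phi>) = {v. Suc v \<in> fv \<phi>}"

record ('f, 'r, 'a) struct =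
  univ :: "'a set"
  fint :: "'f \<Rightarrow> 'a list \<Rightarrow> 'a"
  rint :: "'r \<Rightarrow> 'a list \<Rightarrow> bool"

definition is_struct :: "('f, 'r) lang \<Rightarrow> ('f, 'r, 'a) struct \<Rightarrow> bool" where
  "is_struct L M \<longleftrightarrow> univ M \<noteq> {} \<and>
     (\<forall>f \<in> fsyms L. \<forall>xs. length xs = far L f \<and> set xs \<subseteq> univ M \<longrightarrow> fint M f xs \<in> univ M)"

fun tval :: "('f, 'r, 'a) struct \<Rightarrow> (nat \<Rightarrow> 'a) \<Rightarrow> 'f tm \<Rightarrow> 'a" where
  "tval M e (Var v) = e v"
| "tval M e (Fn f ts) = fint M f (map (tval M e) ts)"

fun sat :: "('f, 'r, 'a) struct \<Rightarrow> (nat \<Rightarrow> 'a) \<Rightarrow> ('f, 'r) fm \<Rightarrow> bool" where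
  "sat M e (Eq s t) \<longleftrightarrow> tval M e s = tval M e t"
| "sat M e (Rel r ts) \<longleftrightarrow> rint M r (map (tval M e) ts)"
| "sat M e (Neg \<phi>) \<longleftrightarrow> \<not> sat M e \<phi>"
| "sat M e (Conj \<phi> \<psi>) \<longleftrightarrow> sat M e \<phi> \<and> sat M e \<psi>"
| "sat M e (Ex \<phi>) \<longleftrightarrow> (\<exists>a \<in> univ M. sat M (case_nat a e) \<phi>)"

definition sentence :: "('f, 'r) lang \<Rightarrow> ('f, 'r) fm \<Rightarrow> bool" where
  "sentence L \<phi> \<longleftrightarrow> wf_fm L \<phi> \<and> fv \<phi> = {}"

definition models :: "('f, 'r) lang \<Rightarrow> ('f, 'r, 'a) struct \<Rightarrow> ('f, 'r) fm set \<Rightarrow> bool" where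
  "models L M T \<longleftrightarrow> is_struct L M \<and>
     (\<forall>\<phi> \<in> T. \<forall>e. range e \<subseteq> univ M \<longrightarrow> sat M e \<phi>)"

text \<open>Theories are taken to be deductively closed. Consistency is not part of this
  definition; wherever it is used, a model of \<open>T\<close> is present.\<close>

definition complete_theory :: "('f, 'r) lang \<Rightarrow> ('f, 'r) fm set \<Rightarrow> bool" where
  "complete_theory L T \<longleftrightarrow> (\<forall>\<phi> \<in> T. sentence L \<phi>) \<and>
     (\<forall>\<phi>. sentence L \<phi> \<longrightarrow> \<phi> \<in> T \<or> Neg \<phi> \<in> T)"

definition elem_sub ::
  "('f, 'r) lang \<Rightarrow> ('f, 'r, 'a) struct \<Rightarrow> ('f, 'r, 'a) struct \<Rightarrow> bool" where
  "elem_sub L M N \<longleftrightarrow> is_struct L M \<and> is_struct L N \<and> univ M \<subseteq> univ N \<and>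
     (\<forall>f \<in> fsyms L. \<forall>xs. length xs = far L f \<and> set xs \<subseteq> univ M \<longrightarrow> fint M f xs = fint N f xs) \<and>
     (\<forall>r \<in> rsyms L. \<forall>xs. length xs = rar L r \<and> set xs \<subseteq> univ M \<longrightarrow> rint M r xs = rint N r xs) \<and>
     (\<forall>\<phi> e. wf_fm L \<phi> \<and> range e \<subseteq> univ M \<longrightarrow> (sat M e \<phi> \<longleftrightarrow> sat N e \<phi>))"


section \<open>Formulas with parameters and partial types\<close>

text \<open>A formula \<open>\<phi>(x, b)\<close> with parameters is the pair \<open>(\<phi>, b)\<close>. If \<open>x\<close> has length \<open>n\<close>,
  the variables \<open>0, \<dots>, n - 1\<close> of \<open>\<phi>\<close> stand for \<open>x\<close> and the next \<open>length b\<close> ones for \<open>b\<close>.\<close>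

type_synonym ('f, 'r, 'a) pfm = "('f, 'r) fm \<times> 'a list"

definition formula_over ::
  "('f, 'r) lang \<Rightarrow> 'a set \<Rightarrow> nat \<Rightarrow> ('f, 'r, 'a) pfm \<Rightarrow> bool" where
  "formula_over L A n \<psi> \<longleftrightarrow> wf_fm L (fst \<psi>) \<and> fv (fst \<psi>) \<subseteq> {..<n + length (snd \<psi>)} \<and>
     set (snd \<psi>) \<subseteq> A"

definition partial_type ::
  "('f, 'r) lang \<Rightarrow> 'a set \<Rightarrow> nat \<Rightarrow> ('f, 'r, 'a) pfm set \<Rightarrow> bool" where
  "partial_type L A n p \<longleftrightarrow> (\<forall>\<psi> \<in> p. formula_over L A n \<psi>)"

definition holds :: "('f, 'r, 'a) struct \<Rightarrow> ('f, 'r, 'a) pfm \<Rightarrow> 'a list \<Rightarrow> bool" where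
  "holds M \<psi> xs \<longleftrightarrow> sat M ((!) (xs @ snd \<psi>)) (fst \<psi>)"

definition solutions ::
  "('f, 'r, 'a) struct \<Rightarrow> nat \<Rightarrow> ('f, 'r, 'a) pfm set \<Rightarrow> 'a list set" where
  "solutions M n p = {xs. length xs = n \<and> set xs \<subseteq> univ M \<and> (\<forall>\<psi> \<in> p. holds M \<psi> xs)}"

definition consistent_in ::
  "('f, 'r, 'a) struct \<Rightarrow> nat \<Rightarrow> ('f, 'r, 'a) pfm set \<Rightarrow> bool" where
  "consistent_in M n p \<longleftrightarrow> (\<forall>q \<subseteq> p. finite q \<longrightarrow> solutions M n q \<noteq> {})"


section \<open>The monster model\<close>

definition small :: "'k rel \<Rightarrow> 'a set \<Rightarrow> bool" where
  "small \<kappa> A \<longleftrightarrow> |A| <o \<kappa>"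

definition saturated :: "'k rel \<Rightarrow> ('f, 'r) lang \<Rightarrow> ('f, 'r, 'a) struct \<Rightarrow> bool" where
  "saturated \<kappa> L M \<longleftrightarrow>
     (\<forall>A n p. A \<subseteq> univ M \<and> small \<kappa> A \<and> partial_type L A n p \<and> consistent_in M n p
        \<longrightarrow> solutions M n p \<noteq> {})"

definition strong_limit :: "'k rel \<Rightarrow> bool" where
  "strong_limit \<kappa> \<longleftrightarrow> Card_order \<kappa> \<and> (\<forall>X \<subseteq> Field \<kappa>. small \<kappa> X \<longrightarrow> small \<kappa> (Pow X))"

text \<open>The cardinal \<open>\<kappa>\<close> is the bound for smallness: small sets and small models are those of
  cardinality \<open>< \<kappa>\<close>. A saturated model \<open>C\<close> in the strict sense is the case \<open>\<kappa> = |univ C|\<close>;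
  allowing other \<open>\<kappa>\<close> includes finite models and does not tie the existence of a monster
  model to inaccessible cardinals. By saturation, every small model of \<open>T\<close> is isomorphic
  to an elementary substructure of \<open>C\<close>.\<close>

definition monster_model ::
  "'k rel \<Rightarrow> ('f, 'r) lang \<Rightarrow> ('f, 'r) fm set \<Rightarrow> ('f, 'r, 'a) struct \<Rightarrow> bool" where
  "monster_model \<kappa> L T C \<longleftrightarrow> strong_limit \<kappa> \<and> small \<kappa> {\<phi>. wf_fm L \<phi>} \<and>
     models L C T \<and> saturated \<kappa> L C"


section \<open>Strong dependence\<close>

definition indiscernible ::
  "('f, 'r) lang \<Rightarrow> ('f, 'r, 'a) struct \<Rightarrow> 'a set \<Rightarrow> nat \<Rightarrow> (nat \<Rightarrow> 'a list) \<Rightarrow> bool" where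
  "indiscernible L M B m s \<longleftrightarrow> (\<forall>j. length (s j) = m \<and> set (s j) \<subseteq> univ M) \<and>
     (\<forall>k \<psi> is js. formula_over L B (k * m) \<psi> \<and>
        length is = k \<and> sorted_wrt (<) is \<and> length js = k \<and> sorted_wrt (<) js \<longrightarrow>
        (holds M \<psi> (concat (map s is)) \<longleftrightarrow> holds M \<psi> (concat (map s js))))"

definition indiscernible_array ::
  "('f, 'r) lang \<Rightarrow> ('f, 'r, 'a) struct \<Rightarrow> 'a set \<Rightarrow> (nat \<Rightarrow> nat) \<Rightarrow>
     (nat \<Rightarrow> nat \<Rightarrow> 'a list) \<Rightarrow> bool" where
  "indiscernible_array L M B m a \<longleftrightarrow>
     (\<forall>i0. indiscernible L M (B \<union> (\<Union>i \<in> - {i0}. \<Union>j. set (a i j))) (m i0) (a i0))"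

text \<open>This is strong dependence of the complete theory of its monster model \<open>C\<close>. The conjunctions
  \<open>\<phi>\<^sub>i(x, a\<^sub>i\<^sub>0) \<and> \<not> \<phi>\<^sub>i(x, a\<^sub>i\<^sub>1)\<close> are split into their conjuncts.\<close>

definition strongly_dependent :: "('f, 'r) lang \<Rightarrow> ('f, 'r, 'a) struct \<Rightarrow> bool" where
  "strongly_dependent L C \<longleftrightarrow>
     \<not> (\<exists>(n :: nat) (m :: nat \<Rightarrow> nat) (\<phi> :: nat \<Rightarrow> ('f, 'r) fm) (a :: nat \<Rightarrow> nat \<Rightarrow> 'a list).
          (\<forall>i. wf_fm L (\<phi> i) \<and> fv (\<phi> i) \<subseteq> {..<n + m i}) \<and>
          indiscernible_array L C {} m a \<and>
          consistent_in C n (\<Union>i. {(\<phi> i, a i 0), (Neg (\<phi> i), a i 1)}))"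


section \<open>Type definable groups\<close>

definition td_group ::
  "('f, 'r, 'a) struct \<Rightarrow> nat \<Rightarrow> ('f, 'r, 'a) pfm set \<Rightarrow> ('f, 'r, 'a) pfm \<Rightarrow> 'a list monoid" where
  "td_group M n \<Sigma> \<nu> =
     (let mul = (\<lambda>x y. THE z. z \<in> solutions M n \<Sigma> \<and> holds M \<nu> (x @ y @ z))
      in \<lparr> carrier = solutions M n \<Sigma>, mult = mul,
           one = (THE e. e \<in> solutions M n \<Sigma> \<and> (\<forall>x \<in> solutions M n \<Sigma>. mul e x = x \<and> mul x e = x)) \<rparr>)"

definition type_definable_group ::
  "('f, 'r) lang \<Rightarrow> ('f, 'r, 'a) struct \<Rightarrow> 'a set \<Rightarrow> nat \<Rightarrow> ('f, 'r, 'a) pfm set \<Rightarrow>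
     ('f, 'r, 'a) pfm \<Rightarrow> bool" where
  "type_definable_group L C A n \<Sigma> \<nu> \<longleftrightarrow>
     partial_type L A n \<Sigma> \<and> formula_over L A (3 * n) \<nu> \<and>
     (\<forall>x \<in> solutions C n \<Sigma>. \<forall>y \<in> solutions C n \<Sigma>.
        \<exists>!z. z \<in> solutions C n \<Sigma> \<and> holds C \<nu> (x @ y @ z)) \<and>
     group (td_group C n \<Sigma> \<nu>)"

text \<open>The cardinals and the models of \<open>T\<close> in the definition of unbounded index are, as always
  inside a monster model, the small cardinals and the small elementary substructures of \<open>C\<close>.
  Here \<open>K\<close> and \<open>H\<close> are the partial types of the larger group and of its subgroup, both
  over \<open>A\<close>; they share the operation \<open>\<nu>\<close>.\<close>

definition unbounded_index ::
  "'k rel \<Rightarrow> ('f, 'r) lang \<Rightarrow> ('f, 'r, 'a) struct \<Rightarrow> 'a set \<Rightarrow> nat \<Rightarrow> ('f, 'r, 'a) pfm \<Rightarrow>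
     ('f, 'r, 'a) pfm set \<Rightarrow> ('f, 'r, 'a) pfm set \<Rightarrow> bool" where
  "unbounded_index \<kappa> L C A n \<nu> K H \<longleftrightarrow>
     (\<forall>\<mu> :: 'k rel. Card_order \<mu> \<and> \<mu> <o \<kappa> \<longrightarrow>
        (\<exists>M. elem_sub L M C \<and> small \<kappa> (univ M) \<and> A \<subseteq> univ M \<and>
             \<mu> \<le>o card_of (rcosets\<^bsub>td_group M n K \<nu>\<^esub> (solutions M n H))))"

abbreviation bounded_index ::
  "'k rel \<Rightarrow> ('f, 'r) lang \<Rightarrow> ('f, 'r, 'a) struct \<Rightarrow> 'a set \<Rightarrow> nat \<Rightarrow> ('f, 'r, 'a) pfm \<Rightarrow>
     ('f, 'r, 'a) pfm set \<Rightarrow> ('f, 'r, 'a) pfm set \<Rightarrow> bool" where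
  "bounded_index \<kappa> L C A n \<nu> K H \<equiv> \<not> unbounded_index \<kappa> L C A n \<nu> K H"

end

theory Submission
  imports Defs "HOL-Library.Product_Lexorder" "HOL-Library.Countable"
begin

text \<open>Suppose that every index is unbounded. Write \<open>K\<^sub>i\<close> for the intersection of the \<open>G\<^sub>l\<close> with
\<open>l \<noteq> i\<close>. For each \<open>i\<close> there is then a sequence \<open>b\<^sub>i\<^sub>0, b\<^sub>i\<^sub>1, \<dots>\<close> in \<open>K\<^sub>i\<close> whose members are pairwise separated
modulo \<open>G\<^sub>i\<close>, and uniformly so: one finite part \<open>Q\<^sub>i\<close> of the type defining \<open>G\<^sub>i\<close> witnesses all the
separations (\<open>bounded_if_translates_met\<close>, \<open>greedy_sequence\<close>). Otherwise for each such \<open>Q\<close> there would be a finite set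
\<open>F \<subseteq> K\<^sub>i\<close> that meets all translates \<open>Q g\<close> with \<open>g\<close> in \<open>K\<^sub>i\<close>. Modulo \<open>G\<^sub>i\<close>, an element \<open>g\<close> is determined by the points of these
sets that lie in its translates, so the number of cosets would be at most \<open>2\<^sup>\<lambda>\<close>, where \<open>\<lambda>\<close> is the small
number of finite parts, or \<open>\<aleph>\<^sub>0\<close> if that is larger.

The rows \<open>b\<^sub>i\<close> are turned into a mutually indiscernible array \<open>c\<close> over the parameters that still lies in
the groups \<open>K\<^sub>i\<close> and still has \<open>c\<^sub>i\<^sub>0 c\<^sub>i\<^sub>1\<^sup>-\<^sup>1 \<notin> G\<^sub>i\<close> (\<open>mutually_indiscernible_array\<close>,
\<open>ex_separating_array\<close>). Instead of Ramsey's theorem this uses a nonprincipal ultrafilter on the natural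
numbers: a statement about finitely many entries of the array is declared true if it holds for almost all choices of
the columns, the choices being made one after another in lexicographic order. The resulting type is
complete, finitely satisfiable and invariant under order preserving changes of the columns in a row.

Finally, let \<open>\<phi>\<^sub>i(x, y)\<close> say that \<open>x\<close> lies in the translate of \<open>y\<close> by a
finite part of the type of \<open>G\<^sub>i\<close>, chosen by compactness so small that no \<open>x\<close> lies in both of the translates
of \<open>c\<^sub>i\<^sub>0\<close> and \<open>c\<^sub>i\<^sub>1\<close>. The product \<open>x = c\<^sub>0\<^sub>0 c\<^sub>1\<^sub>0 \<dots> c\<^sub>N\<^sub>0\<close> lies in \<open>G\<^sub>i c\<^sub>i\<^sub>0\<close> for every \<open>i \<le> N\<close>, because all other
factors lie in the normal subgroup \<open>G\<^sub>i\<close>. So it satisfies \<open>\<phi>\<^sub>i(x, c\<^sub>i\<^sub>0) \<and> \<not> \<phi>\<^sub>i(x, c\<^sub>i\<^sub>1)\<close> for all these \<open>i\<close> at once,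
and strong dependence fails (\<open>not_strongly_dependent\<close>).

Formulas are handled semantically throughout: a relation on assignments \<open>'v \<Rightarrow> 'a\<close> is \<open>definable\<close> if some
formula with parameters defines it, and the closure properties of this notion hide the de Bruijn indices.\<close>

section \<open>Renaming of variables\<close>

fun ren_tm :: "(nat \<Rightarrow> nat) \<Rightarrow> 'f tm \<Rightarrow> 'f tm" where
  "ren_tm h (Var v) = Var (h v)"
| "ren_tm h (Fn f ts) = Fn f (map (ren_tm h) ts)"

fun ren :: "(nat \<Rightarrow> nat) \<Rightarrow> ('f, 'r) fm \<Rightarrow> ('f, 'r) fm" where
  "ren h (Eq s t) = Eq (ren_tm h s) (ren_tm h t)"
| "ren h (Rel r ts) = Rel r (map (ren_tm h) ts)"
| "ren h (Neg \<phi>) = Neg (ren h \<phi>)"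
| "ren h (Conj \<phi> \<psi>) = Conj (ren h \<phi>) (ren h \<psi>)"
| "ren h (Ex \<phi>) = Ex (ren (case_nat 0 (Suc \<circ> h)) \<phi>)"

lemma finite_fv: "finite (fv \<phi>)"
proof -
  have tm: "finite (fv_tm t)" for t :: "'f tm" by (induction t) auto
  show ?thesis
  proof (induction \<phi>)
    case (Ex \<phi>)
    have "Suc ` fv (fm.Ex \<phi>) \<subseteq> fv \<phi>" by auto
    then have "finite (Suc ` fv (fm.Ex \<phi>))" using Ex finite_subset by blast
    then show ?case by (simp add: finite_image_iff)
  qed (auto simp: tm)
qed

lemma tval_cong: "(\<And>v. v \<in> fv_tm t \<Longrightarrow> e v = e' v) \<Longrightarrow> tval M e t = tval M e' t"
proof (induction t)
  case (Fn f ts)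
  then have "map (tval M e) ts = map (tval M e') ts" by (auto intro!: map_cong)
  then show ?case by (metis tval.simps(2))
qed simp

lemma sat_cong: "(\<And>v. v \<in> fv \<phi> \<Longrightarrow> e v = e' v) \<Longrightarrow> sat M e \<phi> = sat M e' \<phi>"
proof (induction \<phi> arbitrary: e e')
  case (Eq s t) then show ?case using tval_cong[of s e e' M] tval_cong[of t e e' M] by auto
next
  case (Rel r ts)
  have "map (tval M e) ts = map (tval M e') ts" using Rel by (auto intro!: map_cong tval_cong)
  then show ?case by (metis sat.simps(2))
next
  case (Ex \<phi>)
  have "sat M (case_nat a e) \<phi> = sat M (case_nat a e') \<phi>" for a
    by (rule Ex.IH) (use Ex.prems in \<open>auto split: nat.split\<close>)
  then show ?case by simp
next
  case (Neg \<phi>)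
  show ?case using Neg.IH[of e e'] Neg.prems by simp
next
  case (Conj \<phi> \<psi>)
  show ?case using Conj.IH(1)[of e e'] Conj.IH(2)[of e e'] Conj.prems by simp
qed

lemma tval_ren: "tval M e (ren_tm h t) = tval M (e \<circ> h) t"
proof (induction t)
  case (Fn f ts)
  then have "map (tval M e) (map (ren_tm h) ts) = map (tval M (e \<circ> h)) ts" by (simp add: comp_def)
  then show ?case by (metis ren_tm.simps(2) tval.simps(2))
qed simp

lemma sat_ren: "sat M e (ren h \<phi>) = sat M (e \<circ> h) \<phi>"
proof (induction \<phi> arbitrary: e h)
  case (Rel r ts)
  have "map (tval M e) (map (ren_tm h) ts) = map (tval M (e \<circ> h)) ts" by (simp add: tval_ren comp_def)
  then show ?case by (metis ren.simps(2) sat.simps(2))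
next
  case (Ex \<phi>)
  have eq: "case_nat a e \<circ> case_nat 0 (Suc \<circ> h) = case_nat a (e \<circ> h)" for a
    by (rule ext) (auto split: nat.split)
  show ?case by (simp only: ren.simps sat.simps Ex.IH eq)
qed (auto simp: tval_ren)

lemma wf_ren: "wf_fm L (ren h \<phi>) = wf_fm L \<phi>"
proof -
  have tm: "wf_tm L (ren_tm h t) = wf_tm L t" for h and t :: "'a tm" by (induction t) auto
  show ?thesis by (induction \<phi> arbitrary: h) (auto simp: tm)
qed

lemma fv_ren: "fv (ren h \<phi>) = h ` fv \<phi>"
proof -
  have tm: "fv_tm (ren_tm h t) = h ` fv_tm t" for h and t :: "'a tm" by (induction t) auto
  show ?thesis
  proof (induction \<phi> arbitrary: h)
    case (Ex \<phi>)
    have "Suc v \<in> case_nat 0 (Suc \<circ> h) ` fv \<phi> \<longleftrightarrow> v \<in> h ` {v. Suc v \<in> fv \<phi>}" for v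
    proof
      assume "Suc v \<in> case_nat 0 (Suc \<circ> h) ` fv \<phi>"
      then obtain w where w: "w \<in> fv \<phi>" "Suc v = case_nat 0 (Suc \<circ> h) w" by blast
      then show "v \<in> h ` {v. Suc v \<in> fv \<phi>}" by (cases w) auto
    next
      assume "v \<in> h ` {v. Suc v \<in> fv \<phi>}"
      then obtain w where "Suc w \<in> fv \<phi>" "v = h w" by blast
      then show "Suc v \<in> case_nat 0 (Suc \<circ> h) ` fv \<phi>" by (intro image_eqI[of _ _ "Suc w"]) auto
    qed
    then show ?case by (simp add: Ex.IH set_eq_iff)
  qed (auto simp: tm)
qed

section \<open>Definable relations\<close>

abbreviation subst_env :: "('v \<Rightarrow> 'a) \<Rightarrow> 'v + 'a \<Rightarrow> 'a" where
  "subst_env e \<equiv> case_sum e (\<lambda>a. a)"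

text \<open>The map \<open>f\<close> sends each free variable of \<open>\<phi>\<close> either to a variable in \<open>V\<close> or to a parameter in \<open>A\<close>. The variables may come
from any type, for instance pairs \<open>(v, k)\<close> for the \<open>k\<close>-th component of a tuple named \<open>v\<close>, and no order
or number of variables has to be kept in mind.\<close>

definition definable ::
  "('f, 'r) lang \<Rightarrow> ('f, 'r, 'a) struct \<Rightarrow> 'a set \<Rightarrow> 'v set \<Rightarrow> (('v \<Rightarrow> 'a) \<Rightarrow> bool) \<Rightarrow> bool" where
  "definable L M A V R \<longleftrightarrow> (\<exists>\<phi> f. wf_fm L \<phi> \<and> f ` fv \<phi> \<subseteq> V <+> A \<and>
     R = (\<lambda>e. sat M (\<lambda>v. subst_env e (f v)) \<phi>))"

lemma definableI:
  "wf_fm L \<phi> \<Longrightarrow> f ` fv \<phi> \<subseteq> V <+> A \<Longrightarrow> (\<And>e. R e = sat M (\<lambda>v. subst_env e (f v)) \<phi>) \<Longrightarrow>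
   definable L M A V R"
  unfolding definable_def by blast

lemma definable_mono: "definable L M A V R \<Longrightarrow> A \<subseteq> A' \<Longrightarrow> V \<subseteq> V' \<Longrightarrow> definable L M A' V' R"
  unfolding definable_def Plus_def by (meson Un_mono image_mono order_trans)

lemma definable_finite_vars:
  assumes "definable L M A V R"
  obtains V' where "finite V'" "V' \<subseteq> V" "definable L M A V' R"
proof -
  from assms obtain \<phi> f where f: "wf_fm L \<phi>" "f ` fv \<phi> \<subseteq> V <+> A"
    "R = (\<lambda>e. sat M (\<lambda>v. subst_env e (f v)) \<phi>)" unfolding definable_def by blast
  let ?V = "{u. Inl u \<in> f ` fv \<phi>}"
  have "finite ?V"
    using finite_vimageI[OF finite_imageI[OF finite_fv] inj_Inl] by (simp add: vimage_def)
  moreover have "?V \<subseteq> V" using f(2) by auto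
  moreover have "y \<in> ?V <+> A" if "y \<in> f ` fv \<phi>" for y
    using that f(2) by (cases y) auto
  then have "f ` fv \<phi> \<subseteq> ?V <+> A" by blast
  ultimately show ?thesis using that definableI[OF f(1), of f ?V A R M] f(3) by meson
qed

lemma definable_cong_env:
  assumes "definable L M A V R" "\<And>v. v \<in> V \<Longrightarrow> e v = e' v"
  shows "R e = R e'"
proof -
  from assms(1) obtain \<phi> f where f: "f ` fv \<phi> \<subseteq> V <+> A"
    "R = (\<lambda>e. sat M (\<lambda>v. subst_env e (f v)) \<phi>)" unfolding definable_def by blast
  show ?thesis unfolding f(2)
    by (rule sat_cong) (use f(1) assms(2) in \<open>auto simp: Plus_def\<close>)
qed

lemma definable_Neg: "definable L M A V R \<Longrightarrow> definable L M A V (\<lambda>e. \<not> R e)"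
proof -
  assume "definable L M A V R"
  then obtain \<phi> f where f: "wf_fm L \<phi>" "f ` fv \<phi> \<subseteq> V <+> A"
    "R = (\<lambda>e. sat M (\<lambda>v. subst_env e (f v)) \<phi>)" unfolding definable_def by blast
  show ?thesis by (rule definableI[of _ "Neg \<phi>" f]) (use f in auto)
qed

lemma definable_Conj:
  assumes "definable L M A V R" "definable L M A V S"
  shows "definable L M A V (\<lambda>e. R e \<and> S e)"
proof -
  from assms obtain \<phi> f \<psi> g where f: "wf_fm L \<phi>" "f ` fv \<phi> \<subseteq> V <+> A"
    "R = (\<lambda>e. sat M (\<lambda>v. subst_env e (f v)) \<phi>)"
    and g: "wf_fm L \<psi>" "g ` fv \<psi> \<subseteq> V <+> A"
    "S = (\<lambda>e. sat M (\<lambda>v. subst_env e (g v)) \<psi>)" unfolding definable_def by blast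
  \<comment> \<open>Renaming to even and odd indices makes room for two unrelated maps to variables and parameters.\<close>
  let ?h = "\<lambda>v. if even v then f (v div 2) else g (v div 2)"
  let ?\<chi> = "Conj (ren (\<lambda>v. 2 * v) \<phi>) (ren (\<lambda>v. Suc (2 * v)) \<psi>)"
  show ?thesis
    by (rule definableI[of _ ?\<chi> ?h]) (use f g in \<open>auto simp: wf_ren fv_ren sat_ren comp_def\<close>)
qed

lemma definable_Ex:
  assumes "definable L M A V R"
  shows "definable L M A (V - {u}) (\<lambda>e. \<exists>a\<in>univ M. R (e(u := a)))"
proof -
  from assms obtain \<phi> f where f: "wf_fm L \<phi>" "f ` fv \<phi> \<subseteq> V <+> A"
    "R = (\<lambda>e. sat M (\<lambda>v. subst_env e (f v)) \<phi>)" unfolding definable_def by blast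
  let ?h = "\<lambda>v. if f v = Inl u then 0 else Suc v"
  have eq: "(case_nat a (\<lambda>v. subst_env e (f v)) \<circ> ?h) = (\<lambda>v. subst_env (e(u := a)) (f v))" for a e
    by (rule ext) (auto split: sum.split)
  show ?thesis
    by (rule definableI[of _ "Ex (ren ?h \<phi>)" f])
      (use f in \<open>auto simp: wf_ren fv_ren sat_ren eq Plus_def split: if_splits\<close>)
qed

text \<open>Renaming variables, identifying them and filling in parameters are all instances of this one closure property.\<close>

lemma definable_subst:
  assumes "definable L M A V R" "g ` V \<subseteq> W <+> B" "A \<subseteq> B"
  shows "definable L M B W (\<lambda>e. R (\<lambda>v. subst_env e (g v)))"
proof -
  from assms obtain \<phi> f where f: "wf_fm L \<phi>" "f ` fv \<phi> \<subseteq> V <+> A"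
    "R = (\<lambda>e. sat M (\<lambda>v. subst_env e (f v)) \<phi>)" unfolding definable_def by blast
  have "subst_env (\<lambda>v. subst_env e (g v)) x = subst_env e (case_sum g Inr x)" for e x
    by (cases x) auto
  moreover have "case_sum g Inr x \<in> W <+> B" if "x \<in> V <+> A" for x
    using that assms(2,3) by (auto simp: Plus_def)
  ultimately show ?thesis
    by (intro definableI[of _ \<phi> "\<lambda>v. case_sum g Inr (f v)"]) (use f in \<open>auto simp: subset_iff\<close>)
qed

lemma definable_eq: "x \<in> V <+> A \<Longrightarrow> y \<in> V <+> A \<Longrightarrow>
  definable L M A V (\<lambda>e. subst_env e x = subst_env e y)"
  by (rule definableI[of _ "Eq (Var 0) (Var 1)" "\<lambda>v. if v = 0 then x else y"]) auto

lemma definable_True: "definable L M A V (\<lambda>e. True)"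
proof -
  let ?F = "Ex (Eq (Var 0) (Var 0))"
  show ?thesis
  proof (cases "univ M = {}")
    case True
    show ?thesis by (rule definableI[of _ "Neg ?F"]) (auto simp: True)
  next
    case False
    show ?thesis by (rule definableI[of _ "?F"]) (auto simp: False ex_in_conv)
  qed
qed

lemma definable_Ball:
  "finite I \<Longrightarrow> (\<And>i. i \<in> I \<Longrightarrow> definable L M A V (R i)) \<Longrightarrow>
   definable L M A V (\<lambda>e. \<forall>i\<in>I. R i e)"
proof (induction I rule: finite_induct)
  case empty then show ?case by (simp add: definable_True)
next
  case (insert i I)
  then have "definable L M A V (\<lambda>e. R i e \<and> (\<forall>i\<in>I. R i e))" by (intro definable_Conj) auto
  then show ?case by simp
qed

lemma definable_Ex_finite:
  assumes "finite W" "definable L M A V R"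
  shows "definable L M A (V - W)
    (\<lambda>e. \<exists>e'. (\<forall>v\<in>W. e' v \<in> univ M) \<and> (\<forall>v. v \<notin> W \<longrightarrow> e' v = e v) \<and> R e')"
  using assms
proof (induction W rule: finite_induct)
  case empty
  have "(\<exists>e'. (\<forall>v. e' v = e v) \<and> R e') = R e" for e by (auto simp flip: fun_eq_iff)
  then show ?case using empty by simp
next
  case (insert u W)
  let ?R = "\<lambda>e. \<exists>e'. (\<forall>v\<in>W. e' v \<in> univ M) \<and> (\<forall>v. v \<notin> W \<longrightarrow> e' v = e v) \<and> R e'"
  have eq: "(\<exists>a\<in>univ M. ?R (e(u := a))) \<longleftrightarrow>
     (\<exists>e'. (\<forall>v\<in>insert u W. e' v \<in> univ M) \<and> (\<forall>v. v \<notin> insert u W \<longrightarrow> e' v = e v) \<and> R e')" (is "?l = ?r") for e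
  proof
    assume ?l
    then obtain a e' where e: "a \<in> univ M" "\<forall>v\<in>W. e' v \<in> univ M"
        "\<forall>v. v \<notin> W \<longrightarrow> e' v = (e(u := a)) v" "R e'" by blast
    have "e' u = a" using e(3) insert(2) by auto
    then show ?r using e by (intro exI[of _ e']) auto
  next
    assume ?r
    then obtain e' where e: "\<forall>v\<in>insert u W. e' v \<in> univ M"
        "\<forall>v. v \<notin> insert u W \<longrightarrow> e' v = e v" "R e'" by blast
    then show ?l by (intro bexI[of _ "e' u"] exI[of _ e']) auto
  qed
  have "definable L M A (V - W - {u}) (\<lambda>e. \<exists>a\<in>univ M. ?R (e(u := a)))"
    by (rule definable_Ex) (use insert in auto)
  moreover have "V - W - {u} = V - insert u W" by auto
  ultimately show ?case unfolding eq by simp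
qed

text \<open>The way from formulas with parameters to definable relations: \<open>gs\<close> lists, for each argument place, a
variable or a parameter.\<close>

lemma definable_holds:
  assumes "formula_over L A (length gs) \<psi>" "set gs \<subseteq> V <+> B" "A \<subseteq> B"
  shows "definable L M B V (\<lambda>e. holds M \<psi> (map (subst_env e) gs))"
proof (rule definableI[of _ "fst \<psi>" "(!) (gs @ map Inr (snd \<psi>))"])
  show "wf_fm L (fst \<psi>)" using assms by (simp add: formula_over_def)
  have len: "v < length (gs @ map Inr (snd \<psi>))" if "v \<in> fv (fst \<psi>)" for v
    using assms(1) that by (auto simp: formula_over_def)
  have "set (gs @ map Inr (snd \<psi>)) \<subseteq> V <+> B"
    using assms by (auto simp: formula_over_def Plus_def)
  then show "(!) (gs @ map Inr (snd \<psi>)) ` fv (fst \<psi>) \<subseteq> V <+> B"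
    using len by (meson image_subsetI nth_mem subsetD)
  show "holds M \<psi> (map (subst_env e) gs) =
      sat M (\<lambda>v. subst_env e ((gs @ map Inr (snd \<psi>)) ! v)) (fst \<psi>)" for e
    unfolding holds_def
  proof (rule sat_cong)
    fix v assume v: "v \<in> fv (fst \<psi>)"
    have "map (subst_env e) (gs @ map Inr (snd \<psi>)) = map (subst_env e) gs @ snd \<psi>"
      by (simp add: comp_def)
    then show "(map (subst_env e) gs @ snd \<psi>) ! v = subst_env e ((gs @ map Inr (snd \<psi>)) ! v)"
      using nth_map[OF len[OF v], of "subst_env e"] by simp
  qed
qed

text \<open>The way back: the parameters of the formula are enumerated and attached to the given list of variables.\<close>

lemma definable_pfm:
  assumes "definable L M A (set vs) R" "distinct vs"
  obtains \<psi> where "formula_over L A (length vs) \<psi>" "\<And>e. holds M \<psi> (map e vs) = R e"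
proof -
  from assms obtain \<phi> f where f: "wf_fm L \<phi>" "f ` fv \<phi> \<subseteq> set vs <+> A"
    "R = (\<lambda>e. sat M (\<lambda>v. subst_env e (f v)) \<phi>)" unfolding definable_def by blast
  obtain ps where ps: "set ps = {a. Inr a \<in> f ` fv \<phi>}"
  proof -
    have "finite {a. Inr a \<in> f ` fv \<phi>}"
      using finite_vimageI[OF finite_imageI[OF finite_fv] inj_Inr] by (simp add: vimage_def)
    from finite_list[OF this] that show ?thesis by blast
  qed
  let ?gs = "map Inl vs @ map Inr ps"
  have "\<forall>v\<in>fv \<phi>. \<exists>k < length ?gs. ?gs ! k = f v"
  proof
    fix v assume v: "v \<in> fv \<phi>"
    then have "f v \<in> set vs <+> A" "f v \<in> f ` fv \<phi>" using f(2) by blast+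
    then have "f v \<in> set ?gs" using ps by (cases "f v") auto
    then show "\<exists>k < length ?gs. ?gs ! k = f v" by (metis in_set_conv_nth)
  qed
  then obtain h where "\<forall>v\<in>fv \<phi>. h v < length ?gs \<and> ?gs ! h v = f v"
    using bchoice[of "fv \<phi>" "\<lambda>v k. k < length ?gs \<and> ?gs ! k = f v"] by blast
  then have h: "h v < length ?gs" "?gs ! h v = f v" if "v \<in> fv \<phi>" for v using that by blast+
  show ?thesis
  proof (rule that[of "(ren h \<phi>, ps)"])
    have "set ps \<subseteq> A" using f(2) ps by auto
    then show "formula_over L A (length vs) (ren h \<phi>, ps)"
      using f(1) h(1) by (auto simp: formula_over_def wf_ren fv_ren)
    fix e
    show "holds M (ren h \<phi>, ps) (map e vs) = R e"
      unfolding holds_def f(3) fst_conv snd_conv sat_ren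
    proof (rule sat_cong)
      fix v assume v: "v \<in> fv \<phi>"
      have gs: "map e vs @ ps = map (subst_env e) ?gs" by (simp add: comp_def)
      have "map (subst_env e) ?gs ! h v = subst_env e (f v)"
        unfolding nth_map[OF h(1)[OF v]] h(2)[OF v] ..
      then show "((!) (map e vs @ ps) \<circ> h) v = subst_env e (f v)"
        unfolding gs comp_apply .
    qed
  qed
qed

section \<open>Small sets\<close>

lemma small_if_inj:
  assumes "small \<kappa> B" "inj_on f A" "f ` A \<subseteq> B"
  shows "small \<kappa> A"
proof -
  have "|A| \<le>o |B|" unfolding card_of_ordLeq[symmetric] using assms by blast
  then show ?thesis using assms(1) unfolding small_def by (rule ordLeq_ordLess_trans)
qed

lemma small_subset: "small \<kappa> B \<Longrightarrow> A \<subseteq> B \<Longrightarrow> small \<kappa> A"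
  by (rule small_if_inj[of \<kappa> B "\<lambda>x. x"]) auto

lemma small_Pow:
  assumes "strong_limit \<kappa>" "small \<kappa> S"
  shows "small \<kappa> (Pow S)"
proof -
  have \<kappa>: "Card_order \<kappa>" using assms(1) by (simp add: strong_limit_def)
  have "|S| \<le>o \<kappa>" using assms(2) unfolding small_def by (rule ordLess_imp_ordLeq)
  then have "|S| \<le>o |Field \<kappa>|"
    by (rule ordLeq_ordIso_trans[OF _ ordIso_symmetric[OF card_of_Field_ordIso[OF \<kappa>]]])
  then obtain f where f: "inj_on f S" "f ` S \<subseteq> Field \<kappa>" unfolding card_of_ordLeq[symmetric] by blast
  have "small \<kappa> (f ` S)"
    by (rule small_if_inj[OF assms(2), of "inv_into S f"])
      (use f in \<open>auto intro: inj_on_inv_into\<close>)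
  then have "small \<kappa> (Pow (f ` S))" using assms(1) f(2) unfolding strong_limit_def by blast
  then show ?thesis
    by (rule small_if_inj[of _ _ "image f"]) (use f(1) in \<open>auto intro!: inj_on_image_Pow\<close>)
qed

text \<open>A language always has infinitely many formulas, so the bound \<open>\<kappa>\<close> of a monster model exceeds
\<open>\<aleph>\<^sub>0\<close>. It need not be regular, so that unions of small families of small sets have to be avoided.\<close>

locale uncountable_strong_limit =
  fixes \<kappa> :: "'k rel"
  assumes strong_limit: "strong_limit \<kappa>"
    and small_nat: "small \<kappa> (UNIV :: nat set)"
begin

lemma Card_order: "Card_order \<kappa>"
  using strong_limit by (simp add: strong_limit_def)

lemma infinite_Field: "\<not> finite (Field \<kappa>)"
proof
  assume fin: "finite (Field \<kappa>)"
  have "|UNIV :: nat set| \<le>o |Field \<kappa>|"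
    by (rule ordLeq_ordIso_trans[OF _ ordIso_symmetric[OF card_of_Field_ordIso[OF Card_order]]])
      (use small_nat in \<open>auto simp: small_def intro: ordLess_imp_ordLeq\<close>)
  from card_of_ordLeq_finite[OF this fin] show False by simp
qed

lemma small_Un: "small \<kappa> A \<Longrightarrow> small \<kappa> B \<Longrightarrow> small \<kappa> (A \<union> B)"
  unfolding small_def by (rule card_of_Un_ordLess_infinite_Field[OF infinite_Field Card_order])

lemma small_finite:
  fixes A :: "'a set"
  assumes "finite A"
  shows "small \<kappa> A"
proof -
  obtain f :: "'a \<Rightarrow> nat" where "inj_on f A" using finite_imp_inj_to_nat_seg[OF assms] by blast
  then show ?thesis by (rule small_if_inj[OF small_nat]) simp
qed

lemma small_Times:
  assumes "small \<kappa> A" "small \<kappa> B"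
  shows "small \<kappa> (A \<times> B)"
proof -
  \<comment> \<open>Strong limits need only bound power sets, so products and lists are embedded in iterated power sets.\<close>
  let ?f = "\<lambda>(a, b). {{Inl a}, {Inr b}}"
  have "small \<kappa> (A <+> B)" using assms unfolding small_def
    by (rule card_of_Plus_ordLess_infinite_Field[OF infinite_Field Card_order])
  then have "small \<kappa> (Pow (Pow (A <+> B)))" by (intro small_Pow strong_limit)
  then show ?thesis
  proof (rule small_if_inj[where f = ?f])
    show "inj_on ?f (A \<times> B)" by (auto simp: inj_on_def doubleton_eq_iff)
    show "?f ` (A \<times> B) \<subseteq> Pow (Pow (A <+> B))" by auto
  qed
qed

lemma small_lists:
  assumes "small \<kappa> A"
  shows "small \<kappa> (lists A)"
proof -
  \<comment> \<open>A list is coded by its graph.\<close>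
  let ?f = "\<lambda>xs. {(k, xs ! k) |k. k < length xs}"
  have "small \<kappa> (Pow ((UNIV :: nat set) \<times> A))"
    using small_Pow[OF strong_limit small_Times[OF small_nat assms]] .
  then show ?thesis
  proof (rule small_if_inj[where f = ?f])
    show "inj_on ?f (lists A)"
    proof (rule inj_onI)
      fix xs ys assume eq: "?f xs = ?f ys"
      have "k < length xs \<longleftrightarrow> k < length ys" for k using eq by (auto simp: set_eq_iff)
      then have "length xs = length ys" by (metis linorder_neqE_nat less_irrefl)
      moreover have "xs ! k = ys ! k" if "k < length xs" for k using eq that by (auto simp: set_eq_iff)
      ultimately show "xs = ys" by (simp add: nth_equalityI)
    qed
    show "?f ` lists A \<subseteq> Pow (UNIV \<times> A)" by (auto simp: in_lists_conv_set)
  qed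
qed

lemma small_partial_type:
  assumes "small \<kappa> {\<phi> :: ('f, 'r) fm. wf_fm L \<phi>}" "small \<kappa> A" "partial_type L A n p"
  shows "small \<kappa> p"
proof (rule small_subset)
  show "small \<kappa> ({\<phi>. wf_fm L \<phi>} \<times> lists A)" by (intro small_Times small_lists assms)
  show "p \<subseteq> {\<phi>. wf_fm L \<phi>} \<times> lists A"
    using assms(3) by (force simp: partial_type_def formula_over_def)
qed

end

section \<open>Saturation\<close>

definition fin_sat :: "'a set \<Rightarrow> (('v \<Rightarrow> 'a) \<Rightarrow> bool) set \<Rightarrow> bool" where
  "fin_sat X F \<longleftrightarrow> (\<forall>Q \<subseteq> F. finite Q \<longrightarrow> (\<exists>e. range e \<subseteq> X \<and> (\<forall>R\<in>Q. R e)))"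

locale saturated_model = uncountable_strong_limit \<kappa> for \<kappa> :: "'k rel" +
  fixes L :: "('f, 'r) lang" and C :: "('f, 'r, 'a) struct"
  assumes saturated: "saturated \<kappa> L C"
    and small_lang: "small \<kappa> {\<phi> :: ('f, 'r) fm. wf_fm L \<phi>}"
    and univ_nonempty: "univ C \<noteq> {}"
begin

text \<open>The one-step extension: the formulas "some assignment with the value \<open>x\<close> at \<open>u\<close> satisfies all of \<open>Q\<close>", for finite \<open>Q \<subseteq> F\<close>,
form a type in the single variable \<open>x\<close>, and its realisations are the values of \<open>u\<close> that keep \<open>F\<close> finitely satisfiable.\<close>

lemma extend_fin_sat:
  assumes A: "A \<subseteq> univ C" "small \<kappa> A"
    and F: "\<And>R. R \<in> F \<Longrightarrow> definable L C A UNIV R"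
    and sat: "fin_sat (univ C) F"
  obtains a where "a \<in> univ C" "fin_sat (univ C) (insert (\<lambda>e. e u = a) F)"
proof -
  have ex: "\<exists>\<psi>. formula_over L A 1 \<psi> \<and>
    (\<forall>a\<in>univ C. holds C \<psi> [a] \<longleftrightarrow> (\<exists>e. range e \<subseteq> univ C \<and> e u = a \<and> (\<forall>R\<in>Q. R e)))"
    if Q: "Q \<subseteq> F" "finite Q" for Q
  proof -
    have "definable L C A UNIV (\<lambda>e. \<forall>R\<in>Q. R e)"
      by (rule definable_Ball) (use Q F in auto)
    then obtain V where V: "finite V" "definable L C A V (\<lambda>e. \<forall>R\<in>Q. R e)"
      by (rule definable_finite_vars) auto
    let ?W = "V - {u}"
    let ?S = "\<lambda>e. \<exists>e'. (\<forall>v\<in>?W. e' v \<in> univ C) \<and> (\<forall>v. v \<notin> ?W \<longrightarrow> e' v = e v) \<and> (\<forall>R\<in>Q. R e')"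
    have "definable L C A (V - ?W) ?S" by (rule definable_Ex_finite) (use V in auto)
    then have "definable L C A (set [u]) ?S" by (rule definable_mono) auto
    then obtain \<psi> where \<psi>: "formula_over L A (length [u]) \<psi>" "\<And>e. holds C \<psi> (map e [u]) = ?S e"
      by (rule definable_pfm) auto
    have "holds C \<psi> [a] \<longleftrightarrow> (\<exists>e. range e \<subseteq> univ C \<and> e u = a \<and> (\<forall>R\<in>Q. R e))"
      if a: "a \<in> univ C" for a
    proof -
      have "holds C \<psi> [a] = ?S (\<lambda>_. a)" using \<psi>(2)[of "\<lambda>_. a"] by simp
      also have "\<dots> \<longleftrightarrow> (\<exists>e. range e \<subseteq> univ C \<and> e u = a \<and> (\<forall>R\<in>Q. R e))" (is "_ \<longleftrightarrow> ?r")
      proof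
        assume "?S (\<lambda>_. a)"
        then obtain e' where e': "\<forall>v\<in>?W. e' v \<in> univ C" "\<forall>v. v \<notin> ?W \<longrightarrow> e' v = a" "\<forall>R\<in>Q. R e'"
          by blast
        have "e' v \<in> univ C" for v using e'(1,2) a by (cases "v \<in> ?W") auto
        then have "range e' \<subseteq> univ C" by blast
        moreover have "e' u = a" using e'(2) by simp
        ultimately show ?r using e'(3) by blast
      next
        assume ?r
        then obtain e where e: "range e \<subseteq> univ C" "e u = a" "\<forall>R\<in>Q. R e" by blast
        \<comment> \<open>Only the variables of the formula are quantified, so values elsewhere are reset to a.\<close>
    let ?e = "\<lambda>v. if v \<in> ?W then e v else a"
        have "(\<forall>R\<in>Q. R ?e) = (\<forall>R\<in>Q. R e)"
          by (rule definable_cong_env[OF V(2)]) (use e(2) in auto)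
        moreover have "\<forall>v\<in>?W. ?e v \<in> univ C" using e(1) by auto
        ultimately show "?S (\<lambda>_. a)" using e(3) by (intro exI[of _ ?e]) simp
      qed
      finally show ?thesis .
    qed
    then show ?thesis using \<psi>(1) by (intro exI[of _ \<psi>]) simp
  qed
  define \<Psi> where "\<Psi> Q = (SOME \<psi>. formula_over L A 1 \<psi> \<and>
    (\<forall>a\<in>univ C. holds C \<psi> [a] \<longleftrightarrow> (\<exists>e. range e \<subseteq> univ C \<and> e u = a \<and> (\<forall>R\<in>Q. R e))))" for Q
  have \<Psi>: "formula_over L A 1 (\<Psi> Q)"
    "\<And>a. a \<in> univ C \<Longrightarrow> holds C (\<Psi> Q) [a] \<longleftrightarrow> (\<exists>e. range e \<subseteq> univ C \<and> e u = a \<and> (\<forall>R\<in>Q. R e))"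
    if "Q \<subseteq> F" "finite Q" for Q
    using someI_ex[OF ex[OF that]] unfolding \<Psi>_def by blast+
  let ?p = "\<Psi> ` {Q. Q \<subseteq> F \<and> finite Q}"
  have "partial_type L A 1 ?p" unfolding partial_type_def using \<Psi>(1) by auto
  moreover have "consistent_in C 1 ?p"
    unfolding consistent_in_def
  proof (intro allI impI)
    fix q assume "q \<subseteq> ?p" "finite q"
    then obtain QQ where QQ: "QQ \<subseteq> {Q. Q \<subseteq> F \<and> finite Q}" "finite QQ" "q = \<Psi> ` QQ"
      by (meson finite_subset_image)
    have "\<Union>QQ \<subseteq> F" "finite (\<Union>QQ)" using QQ by auto
    then obtain e where e: "range e \<subseteq> univ C" "\<forall>R\<in>\<Union>QQ. R e"
      using sat unfolding fin_sat_def by meson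
    have "holds C (\<Psi> Q) [e u]" if "Q \<in> QQ" for Q
      using \<Psi>(2)[of Q "e u"] that QQ(1) e by blast
    then have "[e u] \<in> solutions C 1 q"
      unfolding solutions_def QQ(3) using e(1) by auto
    then show "solutions C 1 q \<noteq> {}" by blast
  qed
  ultimately have "solutions C 1 ?p \<noteq> {}" using saturated A unfolding saturated_def by blast
  then obtain xs where xs: "length xs = 1" "set xs \<subseteq> univ C" "\<forall>\<psi>\<in>?p. holds C \<psi> xs"
    unfolding solutions_def by blast
  then obtain a where a: "xs = [a]" "a \<in> univ C" by (cases xs) auto
  have "fin_sat (univ C) (insert (\<lambda>e. e u = a) F)"
    unfolding fin_sat_def
  proof (intro allI impI)
    fix Q assume Q: "Q \<subseteq> insert (\<lambda>e. e u = a) F" "finite Q"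
    let ?Q = "Q - {\<lambda>e. e u = a}"
    have Q': "?Q \<subseteq> F" "finite ?Q" using Q by auto
    then have "holds C (\<Psi> ?Q) [a]" using xs(3) a(1) by auto
    then obtain e where "range e \<subseteq> univ C" "e u = a" "\<forall>R\<in>?Q. R e"
      using \<Psi>(2)[OF Q' a(2)] by blast
    then show "\<exists>e. range e \<subseteq> univ C \<and> (\<forall>R\<in>Q. R e)" by (intro exI[of _ e]) auto
  qed
  then show ?thesis using that a(2) by blast
qed

text \<open>Saturation speaks of finitely many variables. Infinitely many are realised by fixing the values one after another:
finite satisfiability is kept at each step, and each relation depends on finitely many values, so it holds for the
assignment obtained in the limit.\<close>

lemma realise_nat:
  fixes F :: "((nat \<Rightarrow> 'a) \<Rightarrow> bool) set"
  assumes A: "A \<subseteq> univ C" "small \<kappa> A"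
    and F: "\<And>R. R \<in> F \<Longrightarrow> definable L C A UNIV R"
    and sat: "fin_sat (univ C) F"
  obtains e where "range e \<subseteq> univ C" "\<And>R. R \<in> F \<Longrightarrow> R e"
proof -
  define G where "G xs = F \<union> (\<lambda>k e. e k = xs ! k) ` {..<length xs}" for xs :: "'a list"
  let ?P = "\<lambda>k xs. length xs = k \<and> set xs \<subseteq> univ C \<and> fin_sat (univ C) (G xs)"
  have "\<exists>f. \<forall>k. ?P k (f k) \<and> (\<exists>a. f (Suc k) = f k @ [a])"
  proof (rule dependent_nat_choice)
    show "\<exists>xs. ?P 0 xs" using sat by (auto simp: G_def)
    fix xs k assume xs: "?P k xs"
    have def_G: "definable L C (A \<union> set xs) UNIV R" if "R \<in> G xs" for R
    proof (cases "R \<in> F")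
      case True then show ?thesis using definable_mono[OF F] by blast
    next
      case False
      then obtain i where i: "i < length xs" "R = (\<lambda>e. e i = xs ! i)" using \<open>R \<in> G xs\<close> by (auto simp: G_def)
      have "definable L C (A \<union> set xs) UNIV (\<lambda>e. subst_env e (Inl i) = subst_env e (Inr (xs ! i)))"
        by (rule definable_eq) (use i in auto)
      then show ?thesis using i by simp
    qed
    have A': "A \<union> set xs \<subseteq> univ C" "small \<kappa> (A \<union> set xs)"
      using A xs by (auto intro: small_Un small_finite)
    have "fin_sat (univ C) (G xs)" using xs by blast
    from extend_fin_sat[OF A' def_G this, where u = k]
    obtain a where a: "a \<in> univ C" "fin_sat (univ C) (insert (\<lambda>e. e k = a) (G xs))" by blast
    have "insert (\<lambda>e. e k = a) (G xs) = G (xs @ [a])"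
      using xs unfolding G_def
      by (auto simp: lessThan_Suc nth_append image_def)
    then show "\<exists>ys. ?P (Suc k) ys \<and> (\<exists>a. ys = xs @ [a])"
      using a xs by (intro exI[of _ "xs @ [a]"]) simp
  qed
  then obtain f where f: "\<And>k. length (f k) = k" "\<And>k. set (f k) \<subseteq> univ C" "\<And>k. fin_sat (univ C) (G (f k))"
    "\<And>k. \<exists>a. f (Suc k) = f k @ [a]" by blast
  define e where "e k = f (Suc k) ! k" for k
  have e: "f k ! i = e i" if "i < k" for i k
    using that
  proof (induction k)
    case (Suc k)
    obtain a where a: "f (Suc k) = f k @ [a]" using f(4) by blast
    show ?case
    proof (cases "i = k")
      case False then show ?thesis using Suc a f(1)[of k] by (simp add: nth_append)
    qed (simp add: e_def)
  qed simp
  show ?thesis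
  proof (rule that)
    have "e k \<in> set (f (Suc k))" for k unfolding e_def using f(1)[of "Suc k"] by (metis lessI nth_mem)
    then show "range e \<subseteq> univ C" using f(2) by blast
    fix R assume R: "R \<in> F"
    from F[OF R] obtain V where V: "finite V" "definable L C A V R" by (rule definable_finite_vars) auto
    from V(1) obtain k where k: "\<forall>v\<in>V. v < k" using finite_nat_set_iff_bounded by blast
    let ?Q = "insert R ((\<lambda>i e. e i = f k ! i) ` {..<k})"
    have "?Q \<subseteq> G (f k)" "finite ?Q" using R f(1) by (auto simp: G_def)
    then obtain e' where e': "\<forall>R\<in>?Q. R e'" using f(3)[of k] unfolding fin_sat_def by meson
    have "R e = R e'"
      by (rule definable_cong_env[OF V(2)]) (use e' k e in auto)
    then show "R e" using e' by auto
  qed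
qed

lemma realise:
  fixes F :: "(('v :: countable \<Rightarrow> 'a) \<Rightarrow> bool) set"
  assumes A: "A \<subseteq> univ C" "small \<kappa> A"
    and F: "\<And>R. R \<in> F \<Longrightarrow> definable L C A UNIV R"
    and sat: "fin_sat (univ C) F"
  obtains e where "range e \<subseteq> univ C" "\<And>R. R \<in> F \<Longrightarrow> R e"
proof -
  let ?t = "\<lambda>R (e :: nat \<Rightarrow> 'a). R (\<lambda>v. e (to_nat (v :: 'v)))"
  obtain e :: "nat \<Rightarrow> 'a" where e: "range e \<subseteq> univ C" "\<And>R. R \<in> ?t ` F \<Longrightarrow> R e"
  proof (rule realise_nat[OF A, of "?t ` F"])
    fix R assume "R \<in> ?t ` F"
    then obtain R' where R': "R' \<in> F" "R = ?t R'" by blast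
    have "definable L C A UNIV (\<lambda>e :: nat \<Rightarrow> 'a. R' (\<lambda>v. subst_env e (Inl (to_nat v))))"
      by (rule definable_subst[OF F[OF R'(1)]]) auto
    then show "definable L C A UNIV R" using R'(2) by simp
  next
    show "fin_sat (univ C) (?t ` F)"
      unfolding fin_sat_def
    proof (intro allI impI)
      fix Q assume "Q \<subseteq> ?t ` F" "finite Q"
      then obtain Q' where Q': "Q' \<subseteq> F" "finite Q'" "Q = ?t ` Q'" by (meson finite_subset_image)
      then obtain e where e: "range e \<subseteq> univ C" "\<forall>R\<in>Q'. R e" using sat unfolding fin_sat_def by meson
      have "range (\<lambda>k. e (from_nat k)) \<subseteq> univ C" using e(1) by auto
      moreover have "\<forall>R\<in>Q. R (\<lambda>k. e (from_nat k))" using e(2) Q'(3) by simp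
      ultimately show "\<exists>e. range e \<subseteq> univ C \<and> (\<forall>R\<in>Q. R e)" by blast
    qed
  qed blast
  show ?thesis
    by (rule that[of "\<lambda>v. e (to_nat v)"]) (use e in auto)
qed

text \<open>The form used below: a type given by a family indexed by the formulas in \<open>\<Gamma>\<close>, of which only finitely many need
to be satisfied at a time, next to conditions \<open>B\<close> that can be met together from the start.\<close>

lemma realise_family:
  fixes R :: "'q \<Rightarrow> ('v :: countable \<Rightarrow> 'a) \<Rightarrow> bool"
  assumes A: "A \<subseteq> univ C" "small \<kappa> A"
    and R: "\<And>q. q \<in> \<Gamma> \<Longrightarrow> definable L C A UNIV (R q)"
    and B: "\<And>S. S \<in> B \<Longrightarrow> definable L C A UNIV S"
    and sat: "\<And>Q. finite Q \<Longrightarrow> Q \<subseteq> \<Gamma> \<Longrightarrow>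
      \<exists>e. range e \<subseteq> univ C \<and> (\<forall>q\<in>Q. R q e) \<and> (\<forall>S\<in>B. S e)"
  obtains e where "range e \<subseteq> univ C" "\<And>q. q \<in> \<Gamma> \<Longrightarrow> R q e" "\<And>S. S \<in> B \<Longrightarrow> S e"
proof -
  obtain e where "range e \<subseteq> univ C" "\<And>S. S \<in> R ` \<Gamma> \<union> B \<Longrightarrow> S e"
  proof (rule realise[OF A, of "R ` \<Gamma> \<union> B"])
    show "definable L C A UNIV S" if "S \<in> R ` \<Gamma> \<union> B" for S using that R B by blast
    show "fin_sat (univ C) (R ` \<Gamma> \<union> B)"
      unfolding fin_sat_def
    proof (intro allI impI)
      fix Q assume Q: "Q \<subseteq> R ` \<Gamma> \<union> B" "finite Q"
      then have "Q - B \<subseteq> R ` \<Gamma>" "finite (Q - B)" by auto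
      then obtain Q' where Q': "Q' \<subseteq> \<Gamma>" "finite Q'" "Q - B = R ` Q'" by (meson finite_subset_image)
      then obtain e where e: "range e \<subseteq> univ C" "\<forall>q\<in>Q'. R q e" "\<forall>S\<in>B. S e" using sat by meson
      have "S e" if "S \<in> Q" for S
      proof (cases "S \<in> B")
        case False
        then have "S \<in> R ` Q'" using that Q'(3) by blast
        then show ?thesis using e(2) by blast
      qed (use e(3) in blast)
      then show "\<exists>e. range e \<subseteq> univ C \<and> (\<forall>R\<in>Q. R e)" using e(1) by blast
    qed
  qed blast
  then show ?thesis using that by blast
qed

end

section \<open>Elementary substructures\<close>

lemma elem_sub_sat:
  assumes "elem_sub L M C" "wf_fm L \<phi>" "\<And>v. v \<in> fv \<phi> \<Longrightarrow> e v \<in> univ M"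
  shows "sat M e \<phi> = sat C e \<phi>"
proof -
  obtain m where m: "m \<in> univ M" using assms(1) unfolding elem_sub_def is_struct_def by blast
  let ?e = "\<lambda>v. if v \<in> fv \<phi> then e v else m"
  have "range ?e \<subseteq> univ M" using assms(3) m by auto
  then have "sat M ?e \<phi> = sat C ?e \<phi>" using assms(1,2) unfolding elem_sub_def by blast
  moreover have "sat M ?e \<phi> = sat M e \<phi>" "sat C ?e \<phi> = sat C e \<phi>" by (rule sat_cong; simp)+
  ultimately show ?thesis by simp
qed

lemma elem_sub_holds:
  assumes "elem_sub L M C" "formula_over L A (length xs) \<psi>" "A \<subseteq> univ M" "set xs \<subseteq> univ M"
  shows "holds M \<psi> xs = holds C \<psi> xs"
  unfolding holds_def
proof (rule elem_sub_sat[OF assms(1)])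
  show "wf_fm L (fst \<psi>)" using assms(2) by (simp add: formula_over_def)
  fix v assume "v \<in> fv (fst \<psi>)"
  then have "v < length (xs @ snd \<psi>)" using assms(2) by (auto simp: formula_over_def)
  moreover have "set (xs @ snd \<psi>) \<subseteq> univ M" using assms by (auto simp: formula_over_def)
  ultimately show "(xs @ snd \<psi>) ! v \<in> univ M" by (meson nth_mem subsetD)
qed

lemma elem_sub_solutions:
  assumes "elem_sub L M C" "partial_type L A n p" "A \<subseteq> univ M"
  shows "solutions M n p = {xs \<in> solutions C n p. set xs \<subseteq> univ M}"
proof -
  have "univ M \<subseteq> univ C" using assms(1) by (simp add: elem_sub_def)
  moreover have "holds M \<psi> xs = holds C \<psi> xs" if "\<psi> \<in> p" "length xs = n" "set xs \<subseteq> univ M" for \<psi> xs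
    using that assms by (intro elem_sub_holds[OF assms(1) _ assms(3)]) (auto simp: partial_type_def)
  ultimately show ?thesis unfolding solutions_def by auto
qed

text \<open>One variable at a time, its existential quantification is transferred to \<open>M\<close>, which yields a witness there.\<close>

lemma tarski_vaught:
  assumes M: "elem_sub L M C"
    and R: "definable L C (univ M) UNIV R" "R e" "range e \<subseteq> univ C"
  obtains e' where "range e' \<subseteq> univ M" "R e'"
proof -
  obtain m where m: "m \<in> univ M" using M unfolding elem_sub_def is_struct_def by blast
  have step: "\<exists>e'. range e' \<subseteq> univ M \<and> R e'"
    if "finite V" "definable L C (univ M) V R" "R e" "range e \<subseteq> univ C" for V R
    using that
  proof (induction V arbitrary: R rule: finite_induct)
    case empty
    have "R e = R (\<lambda>_. m)" by (rule definable_cong_env[OF empty(1)]) simp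
    then show ?case using empty m by (intro exI[of _ "\<lambda>_. m"]) auto
  next
    case (insert u V)
    let ?R = "\<lambda>e. \<exists>a\<in>univ C. R (e(u := a))"
    have "definable L C (univ M) (insert u V - {u}) ?R" by (rule definable_Ex) (use insert in auto)
    then have "definable L C (univ M) V ?R" by (rule definable_mono) auto
    moreover have "?R e" using insert.prems by (intro bexI[of _ "e u"]) auto
    ultimately obtain e' where e': "range e' \<subseteq> univ M" "?R e'" using insert by blast
    from insert.prems(1) obtain \<phi> f where f: "wf_fm L \<phi>" "f ` fv \<phi> \<subseteq> insert u V <+> univ M"
      "R = (\<lambda>e. sat C (\<lambda>v. subst_env e (f v)) \<phi>)" unfolding definable_def by blast
    let ?g = "\<lambda>v. subst_env e' (f v)"
    let ?h = "\<lambda>v. if f v = Inl u then 0 else Suc v"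
    have gM: "?g v \<in> univ M" if "v \<in> fv \<phi>" for v
    proof -
      have "f v \<in> insert u V <+> univ M" using that f(2) by blast
      then show ?thesis using e'(1) by auto
    qed
    have eq: "case_nat a ?g \<circ> ?h = (\<lambda>v. subst_env (e'(u := a)) (f v))" for a
      by (rule ext) (auto split: sum.split)
    have fvE: "v \<in> fv \<phi>" if "Suc v \<in> fv (ren ?h \<phi>)" for v
      using that by (auto simp: fv_ren split: if_splits)
    have "sat C ?g (Ex (ren ?h \<phi>))" using e'(2) f(3) by (simp add: sat_ren eq)
    then have "sat M ?g (Ex (ren ?h \<phi>))"
      by (subst elem_sub_sat[OF M]) (use f(1) gM fvE in \<open>auto simp: wf_ren\<close>)
    then obtain a where a: "a \<in> univ M" "sat M (case_nat a ?g) (ren ?h \<phi>)" by auto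
    have "sat C (case_nat a ?g) (ren ?h \<phi>)"
      using a(2)
    proof (subst (asm) elem_sub_sat[OF M])
      show "case_nat a ?g v \<in> univ M" if "v \<in> fv (ren ?h \<phi>)" for v
        using that a(1) gM fvE by (cases v) auto
    qed (use f(1) in \<open>auto simp: wf_ren\<close>)
    then have "R (e'(u := a))" unfolding f(3) by (simp add: sat_ren eq)
    moreover have "range (e'(u := a)) \<subseteq> univ M" using e'(1) a(1) by auto
    ultimately show ?case by blast
  qed
  from R(1) obtain V where "finite V" "definable L C (univ M) V R" by (rule definable_finite_vars) auto
  then show ?thesis using step R that by blast
qed

section \<open>Iterated ultrafilter quantifiers\<close>

text \<open>A minimal proper filter below \<open>sequentially\<close> decides every predicate, since otherwise adding the predicate would give a
smaller one.\<close>

lemma ex_ultrafilter: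
  obtains U :: "nat filter" where "U \<noteq> bot" "U \<le> sequentially"
    "\<And>P. eventually P U \<or> eventually (\<lambda>j. \<not> P j) U"
proof -
  let ?A = "{F :: nat filter. F \<noteq> bot \<and> F \<le> sequentially}"
  let ?le = "\<lambda>F G :: nat filter. G \<le> F"
  have "\<exists>U\<in>?A. \<forall>F\<in>?A. ?le U F \<longrightarrow> F = U"
  proof (rule predicate_Zorn)
    show "partial_order_on ?A (relation_of ?le ?A)"
      by (auto simp: partial_order_on_def preorder_on_def refl_on_def trans_def antisym_def relation_of_def)
    fix \<C> assume "\<C> \<in> Chains (relation_of ?le ?A)"
    then have sub: "\<C> \<subseteq> ?A" and ch: "\<And>F G. F \<in> \<C> \<Longrightarrow> G \<in> \<C> \<Longrightarrow> F \<le> G \<or> G \<le> F"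
      by (auto simp: Chains_def relation_of_def)
    show "\<exists>U\<in>?A. \<forall>F\<in>\<C>. ?le F U"
    proof (cases "\<C> = {}")
      case True
      have "sequentially \<in> ?A" by simp
      then show ?thesis using True by blast
    next
      case False
      have fin: "Inf X \<in> \<C>" if "finite X" "X \<noteq> {}" "X \<subseteq> \<C>" for X
        using that
      proof (induction X rule: finite_ne_induct)
        case (insert F X)
        then have "Inf X \<in> \<C>" "F \<in> \<C>" by auto
        with ch[of F "Inf X"] show ?case by (auto simp: inf_absorb1 inf_absorb2)
      qed simp
      have "Inf X \<noteq> bot" if "X \<subseteq> \<C>" "finite X" for X
      proof (cases "X = {}")
        case True
        then have "sequentially \<le> Inf X" by simp
        then show ?thesis by (metis bot.extremum_uniqueI sequentially_bot)
      qed (use fin[of X] that sub in auto)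
      then have "Inf \<C> \<noteq> bot" by (rule Inf_filter_not_bot)
      moreover have "Inf \<C> \<le> sequentially" using False sub by (auto intro: Inf_lower2)
      ultimately show ?thesis by (intro bexI[of _ "Inf \<C>"]) (auto intro: Inf_lower)
    qed
  qed
  then obtain U where U: "U \<noteq> bot" "U \<le> sequentially"
    and max: "\<And>F. F \<noteq> bot \<Longrightarrow> F \<le> U \<Longrightarrow> F = U"
    by (auto intro: order_trans)
  show ?thesis
  proof (rule that[OF U])
    fix P
    show "eventually P U \<or> eventually (\<lambda>j. \<not> P j) U"
    proof (cases "inf U (principal {j. P j}) = bot")
      case True
      then show ?thesis
        using eventually_inf_principal[of "\<lambda>_. False" U "{j. P j}"] by simp
    next
      case False
      then have "inf U (principal {j. P j}) = U" by (intro max) auto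
      then show ?thesis
        using eventually_inf_principal[of P U "{j. P j}"] by simp
    qed
  qed
qed

text \<open>The quantifiers below range over finitely many coordinates, and make sense for predicates that depend only on these.\<close>

definition supported :: "'v set \<Rightarrow> (('v \<Rightarrow> 'b) \<Rightarrow> bool) \<Rightarrow> bool" where
  "supported S P \<longleftrightarrow> (\<forall>s s'. (\<forall>v\<in>S. s v = s' v) \<longrightarrow> P s = P s')"

lemma supportedD: "supported S P \<Longrightarrow> (\<And>v. v \<in> S \<Longrightarrow> s v = s' v) \<Longrightarrow> P s = P s'"
  unfolding supported_def by blast

lemma supported_mono: "supported S P \<Longrightarrow> S \<subseteq> S' \<Longrightarrow> supported S' P"
  unfolding supported_def by blast

locale ultrafilter =
  fixes U :: "nat filter"
  assumes not_bot: "U \<noteq> bot" and le_sequentially: "U \<le> sequentially"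
    and ultra: "eventually P U \<or> eventually (\<lambda>j. \<not> P j) U"
begin

lemma eventually_Not: "eventually (\<lambda>j. \<not> P j) U \<longleftrightarrow> \<not> eventually P U"
proof
  assume "eventually (\<lambda>j. \<not> P j) U"
  show "\<not> eventually P U"
  proof
    assume "eventually P U"
    with \<open>eventually (\<lambda>j. \<not> P j) U\<close> have "eventually (\<lambda>_. False) U"
      by eventually_elim simp
    then show False using not_bot by (simp add: trivial_limit_def)
  qed
qed (use ultra in blast)

primrec iter :: "'v list \<Rightarrow> (('v \<Rightarrow> nat) \<Rightarrow> bool) \<Rightarrow> ('v \<Rightarrow> nat) \<Rightarrow> bool" where
  "iter [] P s = P s"
| "iter (v # vs) P s = eventually (\<lambda>j. iter vs P (s(v := j))) U"

lemma iter_cong: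
  "supported S P \<Longrightarrow> (\<And>v. v \<in> S - set vs \<Longrightarrow> s v = s' v) \<Longrightarrow> iter vs P s = iter vs P s'"
proof (induction vs arbitrary: s s')
  case Nil then show ?case using supportedD[of S P s s'] by simp
next
  case (Cons v vs)
  have "iter vs P (s(v := j)) = iter vs P (s'(v := j))" for j
    by (rule Cons.IH) (use Cons.prems in auto)
  then show ?case by simp
qed

text \<open>Quantifiers over coordinates that the predicate does not depend on are vacuous. This is what makes the truth
values coherent when the set of coordinates grows.\<close>

lemma iter_filter:
  assumes "supported S P"
  shows "iter vs P s = iter (filter (\<lambda>v. v \<in> S) vs) P s"
proof (induction vs arbitrary: s)
  case (Cons v vs)
  show ?case
  proof (cases "v \<in> S")
    case False
    have "iter vs P (s(v := j)) = iter vs P s" for j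
      by (rule iter_cong[OF assms]) (use False in auto)
    then show ?thesis using False Cons not_bot by (simp add: eventually_const)
  qed (simp add: Cons[abs_def] del: fun_upd_apply)
qed simp

lemma iter_Not: "iter vs (\<lambda>s. \<not> P s) s \<longleftrightarrow> \<not> iter vs P s"
  by (induction vs arbitrary: s) (simp_all add: eventually_Not)

lemma iter_Conj: "iter vs (\<lambda>s. P s \<and> Q s) s \<longleftrightarrow> iter vs P s \<and> iter vs Q s"
  by (induction vs arbitrary: s) (simp_all add: eventually_conj_iff)

lemma iter_witness: "iter vs P s \<Longrightarrow> \<exists>s. P s"
proof (induction vs arbitrary: s)
  case (Cons v vs)
  then have "eventually (\<lambda>j. iter vs P (s(v := j))) U" by simp
  then obtain j where "iter vs P (s(v := j))" using eventually_happens not_bot by blast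
  then show ?case by (rule Cons.IH)
qed auto

lemma iter_rename:
  assumes "supported S P" "inj_on \<sigma> S"
  shows "set vs \<subseteq> S \<Longrightarrow> iter (map \<sigma> vs) (\<lambda>s. P (s \<circ> \<sigma>)) s = iter vs P (s \<circ> \<sigma>)"
proof (induction vs arbitrary: s)
  case (Cons v vs)
  have "iter (map \<sigma> vs) (\<lambda>s. P (s \<circ> \<sigma>)) (s(\<sigma> v := j)) = iter vs P ((s \<circ> \<sigma>)(v := j))" for j
  proof -
    have "iter (map \<sigma> vs) (\<lambda>s. P (s \<circ> \<sigma>)) (s(\<sigma> v := j)) = iter vs P (s(\<sigma> v := j) \<circ> \<sigma>)"
      by (rule Cons.IH) (use Cons.prems in auto)
    also have "\<dots> = iter vs P ((s \<circ> \<sigma>)(v := j))"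
    proof (rule iter_cong[OF assms(1)])
      fix w assume "w \<in> S - set vs"
      then have "\<sigma> w = \<sigma> v \<longleftrightarrow> w = v" using assms(2) Cons.prems by (auto dest: inj_onD)
      then show "(s(\<sigma> v := j) \<circ> \<sigma>) w = ((s \<circ> \<sigma>)(v := j)) w" by simp
    qed
    finally show ?thesis .
  qed
  then show ?case by (simp only: list.map iter.simps)
qed (simp add: comp_def)

text \<open>\<open>P\<close> holds for almost all \<open>s\<close>, where the values of \<open>s\<close> are chosen in the order of their coordinates. On
functions with finitely many relevant coordinates, this is the tensor power of the ultrafilter. The default
assignment \<open>\<lambda>_. 0\<close> is overwritten at all coordinates that matter.\<close>

definition generically :: "(('v :: linorder \<Rightarrow> nat) \<Rightarrow> bool) \<Rightarrow> bool" where
  "generically P \<longleftrightarrow> (\<exists>S. finite S \<and> supported S P \<and> iter (sorted_list_of_set S) P (\<lambda>_. 0))"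

lemma iter_sorted_subset:
  assumes "finite S'" "S \<subseteq> S'" "supported S P"
  shows "iter (sorted_list_of_set S') P s = iter (sorted_list_of_set S) P s"
proof -
  have "filter (\<lambda>v. v \<in> S) (sorted_list_of_set S') = sorted_list_of_set S"
    using assms(1,2) finite_subset[OF assms(2,1)]
    by (intro sorted_distinct_set_unique) (auto intro: sorted_filter[where f = "\<lambda>x. x", simplified])
  then show ?thesis using iter_filter[OF assms(3), of "sorted_list_of_set S'" s] by simp
qed

lemma generically_iff:
  assumes "finite S" "supported S P"
  shows "generically P \<longleftrightarrow> iter (sorted_list_of_set S) P s"
proof -
  have s: "iter (sorted_list_of_set S) P s = iter (sorted_list_of_set S) P (\<lambda>_. 0)"
    by (rule iter_cong[OF assms(2)]) (use assms(1) in auto)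
  have "iter (sorted_list_of_set S') P (\<lambda>_. 0) = iter (sorted_list_of_set S) P (\<lambda>_. 0)"
    if "finite S'" "supported S' P" for S'
    using iter_sorted_subset[of "S \<union> S'" S P "\<lambda>_. 0"] iter_sorted_subset[of "S \<union> S'" S' P "\<lambda>_. 0"]
      assms that by simp
  then show ?thesis unfolding s generically_def using assms by blast
qed

lemma generically_Not:
  assumes "finite S" "supported S P"
  shows "generically (\<lambda>s. \<not> P s) \<longleftrightarrow> \<not> generically P"
proof -
  have "supported S (\<lambda>s. \<not> P s)" using assms(2) unfolding supported_def by blast
  then show ?thesis
    using generically_iff[OF assms] generically_iff[OF assms(1), of "\<lambda>s. \<not> P s"] by (simp add: iter_Not)
qed

lemma generically_Conj:
  assumes "finite S" "supported S P" "finite S'" "supported S' Q"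
  shows "generically (\<lambda>s. P s \<and> Q s) \<longleftrightarrow> generically P \<and> generically Q"
proof -
  have sup: "supported (S \<union> S') P" "supported (S \<union> S') Q"
    using assms supported_mono by blast+
  then have "supported (S \<union> S') (\<lambda>s. P s \<and> Q s)" unfolding supported_def by blast
  moreover have "finite (S \<union> S')" using assms by simp
  ultimately show ?thesis
    using generically_iff[of "S \<union> S'" P] generically_iff[of "S \<union> S'" Q]
      generically_iff[of "S \<union> S'" "\<lambda>s. P s \<and> Q s"] sup by (simp add: iter_Conj)
qed

lemma generically_witness: "generically P \<Longrightarrow> \<exists>s. P s"
  unfolding generically_def using iter_witness by blast

lemma generically_mono:
  assumes "finite S" "supported S P" "finite S'" "supported S' Q"
    and "generically P" "\<And>s. P s \<Longrightarrow> Q s"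
  shows "generically Q"
proof (rule ccontr)
  assume "\<not> generically Q"
  then have "generically (\<lambda>s. \<not> Q s)" using generically_Not[OF assms(3,4)] by simp
  moreover have "supported S' (\<lambda>s. \<not> Q s)" using assms(4) unfolding supported_def by blast
  ultimately have "generically (\<lambda>s. P s \<and> \<not> Q s)"
    using generically_Conj[OF assms(1-3)] assms(5) by blast
  then show False using generically_witness assms(6) by blast
qed

lemma generically_increasing:
  assumes "u < v"
  shows "generically (\<lambda>s :: 'v :: linorder \<Rightarrow> nat. s u < s v)"
proof -
  have "supported {u, v} (\<lambda>s :: 'v \<Rightarrow> nat. s u < s v)" by (simp add: supported_def)
  moreover have "sorted_list_of_set {u, v} = [u, v]"
    using assms by (intro sorted_distinct_set_unique) auto
  moreover have "eventually (\<lambda>j. i < j) U" for i :: nat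
    using le_sequentially eventually_gt_at_top[of i] by (rule filter_leD)
  then have "iter [u, v] (\<lambda>s. s u < s v) (\<lambda>_. 0)" using less_imp_neq[OF assms] by simp
  ultimately show ?thesis
    using generically_iff[of "{u, v}" "\<lambda>s. s u < s v"] by (metis finite.emptyI finite_insert)
qed

text \<open>The source of indiscernibility: \<open>\<sigma>\<close> carries the sorted list of coordinates to the sorted list of their images,
so that both sides are the same string of quantifiers.\<close>

lemma generically_rename:
  assumes "finite S" "supported S P" "strict_mono_on S \<sigma>"
  shows "generically (\<lambda>s. P (s \<circ> \<sigma>)) \<longleftrightarrow> generically P"
proof -
  have inj: "inj_on \<sigma> S" using assms(3) by (rule strict_mono_on_imp_inj_on)
  have "map \<sigma> (sorted_list_of_set S) = sorted_list_of_set (\<sigma> ` S)"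
  proof (rule sorted_distinct_set_unique)
    have "mono_on S \<sigma>" using assms(3) by (rule strict_mono_on_imp_mono_on)
    then show "sorted (map \<sigma> (sorted_list_of_set S))"
      using assms(1) sorted_wrt_mono_rel[of "sorted_list_of_set S" "(\<le>)" "\<lambda>x y. \<sigma> x \<le> \<sigma> y"]
      by (auto simp: sorted_map mono_on_def)
    show "distinct (map \<sigma> (sorted_list_of_set S))" using inj assms(1) by (simp add: distinct_map)
  qed (use assms(1) in auto)
  moreover have "supported (\<sigma> ` S) (\<lambda>s. P (s \<circ> \<sigma>))"
    using assms(2) unfolding supported_def by auto
  ultimately show ?thesis
    using generically_iff[of "\<sigma> ` S" "\<lambda>s. P (s \<circ> \<sigma>)"] generically_iff[OF assms(1,2)]
      iter_rename[OF assms(2) inj, of "sorted_list_of_set S"] assms(1) by simp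
qed

end

section \<open>Mutually indiscernible arrays\<close>

definition tup :: "nat \<Rightarrow> ('v \<times> nat \<Rightarrow> 'a) \<Rightarrow> 'v \<Rightarrow> 'a list" where
  "tup n e v = map (\<lambda>k. e (v, k)) [0..<n]"

lemma length_tup [simp]: "length (tup n e v) = n"
  by (simp add: tup_def)

lemma set_tup: "range e \<subseteq> X \<Longrightarrow> set (tup n e v) \<subseteq> X"
  by (auto simp: tup_def)

text \<open>The array obtained by replacing the entry in row \<open>i\<close> and column \<open>j\<close> by the one in column \<open>s (i, j)\<close> of the same row.\<close>

definition subarray ::
  "(nat \<Rightarrow> nat \<Rightarrow> nat \<Rightarrow> 'a) \<Rightarrow> (nat \<times> nat \<Rightarrow> nat) \<Rightarrow> (nat \<times> nat) \<times> nat \<Rightarrow> 'a" where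
  "subarray a s = (\<lambda>((i, j), k). a i (s (i, j)) k)"

lemma ex_strict_mono_map:
  fixes ks js :: "nat list"
  assumes "length ks = length js" "sorted_wrt (<) ks" "sorted_wrt (<) js"
  obtains \<tau> where "map \<tau> ks = js" "strict_mono_on (set ks) \<tau>"
proof -
  let ?\<tau> = "\<lambda>i. the (map_of (zip ks js) i)"
  have dist: "distinct ks" using assms(2) strict_sorted_iff by blast
  have \<tau>: "?\<tau> (ks ! t) = js ! t" if "t < length ks" for t
    using map_of_zip_nth[OF assms(1) dist, of t] that assms(1) by simp
  show ?thesis
  proof (rule that)
    show "map ?\<tau> ks = js" using \<tau> assms(1) by (intro nth_equalityI) auto
    show "strict_mono_on (set ks) ?\<tau>"
    proof (rule strict_mono_onI)
      fix i j assume ij: "i \<in> set ks" "j \<in> set ks" "i < j"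
      then obtain t t' where t: "t < length ks" "i = ks ! t" "t' < length ks" "j = ks ! t'"
        by (metis in_set_conv_nth)
      have "t < t'"
        using ij(3) t sorted_wrt_nth_less[OF assms(2), of t' t] by (metis linorder_cases less_asym less_irrefl)
      then show "?\<tau> i < ?\<tau> j"
        using t \<tau> sorted_wrt_nth_less[OF assms(3), of t t'] assms(1) by simp
    qed
  qed
qed

context saturated_model
begin

text \<open>The new array realises the type of all relations that hold generically for the subarrays of \<open>a\<close>. This type is complete,
so truth in the new array is generic truth, and order preserving changes of the columns in one row do not affect it.
They fix the other rows, whence the entries of these rows may occur as parameters.

The second conclusion transfers properties of pairs in a row from \<open>a\<close> to the new array. In the third one, a tuple \<open>b\<close> of
parameters is attached to the entries, since strong dependence speaks of formulas without further parameters.\<close>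

lemma mutually_indiscernible_array:
  fixes a :: "nat \<Rightarrow> nat \<Rightarrow> nat \<Rightarrow> 'a"
  assumes A: "A \<subseteq> univ C" "small \<kappa> A"
    and a: "\<And>i j k. a i j k \<in> univ C"
  obtains e where "range e \<subseteq> univ C"
    "\<And>R i. definable L C A UNIV R \<Longrightarrow> (\<And>s. s (i, 0) < s (i, 1) \<Longrightarrow> R (subarray a s)) \<Longrightarrow> R e"
    "\<And>i0 b. set b \<subseteq> A \<Longrightarrow>
      indiscernible L C (A \<union> (\<Union>i \<in> - {i0}. \<Union>j. set (tup n e (i, j)))) (n + length b)
        (\<lambda>j. tup n e (i0, j) @ b)"
proof -
  obtain U :: "nat filter" where "U \<noteq> bot" "U \<le> sequentially"
    "\<And>P. eventually P U \<or> eventually (\<lambda>j. \<not> P j) U" using ex_ultrafilter by blast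
  then interpret ultrafilter U by unfold_locales
  let ?gen = "\<lambda>R. generically (\<lambda>s. R (subarray a s))"
  have sup: "\<exists>S. finite S \<and> supported S (\<lambda>s. R (subarray a s))" if R: "definable L C A UNIV R" for R
  proof -
    from R obtain V where V: "finite V" "definable L C A V R" by (rule definable_finite_vars) auto
    have "supported (fst ` V) (\<lambda>s. R (subarray a s))"
      unfolding supported_def
    proof (intro allI impI)
      fix s s' :: "nat \<times> nat \<Rightarrow> nat" assume "\<forall>v\<in>fst ` V. s v = s' v"
      then show "R (subarray a s) = R (subarray a s')"
        by (intro definable_cong_env[OF V(2)]) (force simp: subarray_def)
    qed
    then show ?thesis using V(1) by blast
  qed
  let ?F = "{R. definable L C A UNIV R \<and> ?gen R}"
  have "fin_sat (univ C) ?F"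
    unfolding fin_sat_def
  proof (intro allI impI)
    fix Q assume Q: "Q \<subseteq> ?F" "finite Q"
    have "?gen (\<lambda>e. \<forall>R\<in>Q. R e)"
      using Q(2,1)
    proof (induction Q rule: finite_induct)
      case empty
      show ?case using generically_iff[of "{}" "\<lambda>_. True"] by (simp add: supported_def)
    next
      case (insert R Q)
      obtain S where S: "finite S" "supported S (\<lambda>s. R (subarray a s))"
        using sup[of R] insert.prems by blast
      have "definable L C A UNIV (\<lambda>e. \<forall>R\<in>Q. R e)"
        by (rule definable_Ball) (use insert in auto)
      then obtain S' where S': "finite S'" "supported S' (\<lambda>s. \<forall>R\<in>Q. R (subarray a s))"
        using sup[of "\<lambda>e. \<forall>R\<in>Q. R e"] by blast
      show ?case using generically_Conj[OF S S'] insert by simp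
    qed
    then obtain s where "\<forall>R\<in>Q. R (subarray a s)" using generically_witness by blast
    moreover have "range (subarray a s) \<subseteq> univ C" using a by (auto simp: subarray_def)
    ultimately show "\<exists>e. range e \<subseteq> univ C \<and> (\<forall>R\<in>Q. R e)" by blast
  qed
  then obtain e where e: "range e \<subseteq> univ C" "\<And>R. R \<in> ?F \<Longrightarrow> R e"
    using realise[OF A, of ?F] by blast
  have complete: "R e \<longleftrightarrow> ?gen R" if R: "definable L C A UNIV R" for R
  proof (cases "?gen R")
    case False
    obtain S where S: "finite S" "supported S (\<lambda>s. R (subarray a s))" using sup[OF R] by blast
    have "?gen (\<lambda>e. \<not> R e)" using generically_Not[OF S] False by simp
    then have "(\<lambda>e. \<not> R e) \<in> ?F" using definable_Neg[OF R] by blast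
    then show ?thesis using e(2)[of "\<lambda>e. \<not> R e"] False by blast
  qed (use e(2)[of R] R in blast)
  show ?thesis
  proof (rule that)
    show "range e \<subseteq> univ C" by (rule e(1))
  next
    fix R i assume R: "definable L C A UNIV R" "\<And>s. s (i, 0) < s (i, 1) \<Longrightarrow> R (subarray a s)"
    obtain S where S: "finite S" "supported S (\<lambda>s. R (subarray a s))" using sup[OF R(1)] by blast
    have "supported {(i, 0), (i, 1)} (\<lambda>s :: nat \<times> nat \<Rightarrow> nat. s (i, 0) < s (i, 1))"
      by (simp add: supported_def)
    moreover have "generically (\<lambda>s :: nat \<times> nat \<Rightarrow> nat. s (i, 0) < s (i, 1))"
      by (rule generically_increasing) (simp add: less_prod_def)
    ultimately have "?gen R"
      using generically_mono[OF _ _ S, of "{(i, 0), (i, 1)}" "\<lambda>s. s (i, 0) < s (i, 1)"] R(2) by blast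
    then show "R e" using complete[OF R(1)] by blast
  next
    fix i0 and b :: "'a list" assume b: "set b \<subseteq> A"
    let ?O = "\<Union>i \<in> - {i0}. \<Union>j. set (tup n e (i, j))"
    let ?s = "\<lambda>j. tup n e (i0, j) @ b"
    have "holds C \<psi> (concat (map ?s ks)) = holds C \<psi> (concat (map ?s js))"
      if \<psi>: "formula_over L (A \<union> ?O) (k * (n + length b)) \<psi>"
        and ks: "length ks = k" "sorted_wrt (<) ks" and js: "length js = k" "sorted_wrt (<) js"
      for k \<psi> ks js
    proof -
      have "\<exists>w. subst_env e w = p \<and> (w \<in> Inr ` A \<or> w \<in> Inl ` {((i, j), k). i \<noteq> i0})"
        if "p \<in> set (snd \<psi>)" for p
      proof -
        have "p \<in> A \<union> ?O" using that \<psi> unfolding formula_over_def by blast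
        then consider "p \<in> A" | i j where "i \<noteq> i0" "p \<in> set (tup n e (i, j))" by blast
        then show ?thesis
        proof cases
          case 1 then show ?thesis by (intro exI[of _ "Inr p"]) simp
        next
          case 2
          then obtain k where "p = e ((i, j), k)" by (auto simp: tup_def)
          then show ?thesis using 2(1) by (intro exI[of _ "Inl ((i, j), k)"]) simp
        qed
      qed
      then obtain par where par: "\<And>p. p \<in> set (snd \<psi>) \<Longrightarrow> subst_env e (par p) = p"
        "\<And>p. p \<in> set (snd \<psi>) \<Longrightarrow> par p \<in> Inr ` A \<or> par p \<in> Inl ` {((i, j), k). i \<noteq> i0}" by metis
      \<comment> \<open>The parameters from other rows become variables, so that a single relation over A describes all choices of columns.\<close>
      define row where "row j = map (\<lambda>k. Inl ((i0, j), k)) [0..<n] @ map Inr b" for j :: nat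
      define gs where "gs js = concat (map row js) @ map par (snd \<psi>)" for js :: "nat list"
      define R where "R js e' = holds C (fst \<psi>, []) (map (subst_env e') (gs js))" for js e'
      have row: "map (subst_env e) (row j) = ?s j" for j
        by (simp add: row_def tup_def comp_def)
      have "map (subst_env e) (gs js) = concat (map ?s js) @ snd \<psi>" for js
      proof -
        have "map (subst_env e \<circ> par) (snd \<psi>) = snd \<psi>" by (rule map_idI) (simp add: par(1))
        then show ?thesis by (simp add: gs_def map_concat comp_def row)
      qed
      then have R: "holds C \<psi> (concat (map ?s js)) = R js e" for js
        by (simp add: R_def holds_def)
      have len: "length (gs js) = k * (n + length b) + length (snd \<psi>)" if "length js = k" for js
      proof -
        have "length (concat (map row js)) = length js * (n + length b)"
          by (induction js) (simp_all add: row_def)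
        then show ?thesis using that by (simp add: gs_def)
      qed
      have "par p \<in> UNIV <+> A" if "p \<in> set (snd \<psi>)" for p using par(2)[OF that] by auto
      moreover have "set (row j) \<subseteq> UNIV <+> A" for j using b by (auto simp: row_def)
      ultimately have set_gs: "set (gs js) \<subseteq> UNIV <+> A" for js
        by (simp add: gs_def image_subset_iff UN_subset_iff)
      have def_R: "definable L C A UNIV (R js)" if "length js = k" for js
        unfolding R_def
        by (rule definable_holds[of L "{}"])
          (use \<psi> len[OF that] set_gs in \<open>auto simp: formula_over_def\<close>)
      obtain \<tau> where \<tau>: "map \<tau> ks = js" "strict_mono_on (set ks) \<tau>"
        using ex_strict_mono_map[of ks js] ks js by metis
      define \<sigma> where "\<sigma> = (\<lambda>(i, j). (i, if i = i0 then \<tau> j else j))"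
      let ?S = "{v. \<exists>k. Inl (v, k) \<in> set (gs ks)}"
      have "finite ?S"
      proof (rule finite_subset)
        show "?S \<subseteq> fst ` (Inl -` set (gs ks))" by force
        show "finite (fst ` (Inl -` set (gs ks)))" by (intro finite_imageI finite_vimageI) auto
      qed
      have S: "j \<in> set ks" if mem: "(i0, j) \<in> ?S" for j
      proof -
        obtain k where "Inl ((i0, j), k) \<in> set (gs ks)" using mem by blast
        then consider l where "l \<in> set ks" "Inl ((i0, j), k) \<in> set (row l)"
          | p where "p \<in> set (snd \<psi>)" "par p = Inl ((i0, j), k)" by (auto simp: gs_def)
        then show ?thesis
        proof cases
          case 1 then show ?thesis by (auto simp: row_def)
        next
          case 2 then show ?thesis using par(2)[of p] by auto
        qed
      qed
      have "supported ?S (\<lambda>s. R ks (subarray a s))"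
        unfolding supported_def
      proof (intro allI impI)
        fix s s' :: "nat \<times> nat \<Rightarrow> nat" assume eq: "\<forall>v\<in>?S. s v = s' v"
        have "subst_env (subarray a s) x = subst_env (subarray a s') x" if "x \<in> set (gs ks)" for x
        proof (cases x)
          case (Inl w)
          obtain i j k where w: "w = ((i, j), k)" by (metis surj_pair)
          have "s (i, j) = s' (i, j)" using eq that Inl w by blast
          then show ?thesis using Inl w by (simp add: subarray_def)
        qed simp
        then have "map (subst_env (subarray a s)) (gs ks) = map (subst_env (subarray a s')) (gs ks)"
          by (rule map_cong[OF refl])
        then show "R ks (subarray a s) = R ks (subarray a s')" unfolding R_def by (simp only:)
      qed
      moreover have "strict_mono_on ?S \<sigma>"
      proof (rule strict_mono_onI)
        fix u v assume uv: "u \<in> ?S" "v \<in> ?S" "u < v"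
        obtain i j i' j' where eq: "u = (i, j)" "v = (i', j')" by (cases u, cases v)
        have lt: "i < i' \<or> i = i' \<and> j < j'" using uv(3) eq by (auto simp: less_prod_def)
        have "\<tau> j < \<tau> j'" if "i = i0" "i' = i0" "j < j'"
          using S[of j] S[of j'] uv(1,2) that \<tau>(2) unfolding eq by (auto intro: strict_mono_onD)
        then show "\<sigma> u < \<sigma> v" using lt unfolding eq \<sigma>_def by (auto simp: less_prod_def)
      qed
      ultimately have "generically (\<lambda>s. R ks (subarray a (s \<circ> \<sigma>))) = ?gen (R ks)"
        using generically_rename[OF \<open>finite ?S\<close>, of "\<lambda>s. R ks (subarray a s)" \<sigma>] by blast
      moreover have "R ks (subarray a (s \<circ> \<sigma>)) = R js (subarray a s)" for s
      proof -
        have "map (subst_env (subarray a (s \<circ> \<sigma>))) (row j) = map (subst_env (subarray a s)) (row (\<tau> j))" for j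
          by (simp add: row_def subarray_def \<sigma>_def)
        then have "map (subst_env (subarray a (s \<circ> \<sigma>))) (concat (map row ks)) =
            map (subst_env (subarray a s)) (concat (map row (map \<tau> ks)))"
          by (simp add: map_concat comp_def)
        moreover have "subst_env (subarray a (s \<circ> \<sigma>)) (par p) = subst_env (subarray a s) (par p)"
          if "p \<in> set (snd \<psi>)" for p
          using par(2)[OF that] by (auto simp: subarray_def \<sigma>_def)
        ultimately have "map (subst_env (subarray a (s \<circ> \<sigma>))) (gs ks) = map (subst_env (subarray a s)) (gs js)"
          by (simp add: gs_def \<tau>(1))
        then show ?thesis unfolding R_def by (simp only:)
      qed
      ultimately have "?gen (R js) = ?gen (R ks)" by simp
      then show ?thesis
        unfolding R using complete[OF def_R[OF ks(1)]] complete[OF def_R[OF js(1)]] by simp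
    qed
    moreover have "length (?s j) = n + length b \<and> set (?s j) \<subseteq> univ C" for j
      using b A(1) e(1) set_tup[of e "univ C" n "(i0, j)"] by auto
    ultimately show "indiscernible L C (A \<union> ?O) (n + length b) ?s"
      unfolding indiscernible_def by blast
  qed
qed

end

section \<open>Separated sequences and products of coset representatives\<close>

lemma greedy_sequence:
  assumes "\<And>F. finite F \<Longrightarrow> F \<subseteq> K \<Longrightarrow> \<exists>g\<in>K. \<forall>a\<in>F. \<not> E a g"
  obtains a :: "nat \<Rightarrow> 'b" where "\<And>j. a j \<in> K" "\<And>j j'. j < j' \<Longrightarrow> \<not> E (a j) (a j')"
proof -
  obtain pick where pick: "\<And>F. finite F \<Longrightarrow> F \<subseteq> K \<Longrightarrow> pick F \<in> K \<and> (\<forall>a\<in>F. \<not> E a (pick F))"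
    using assms by metis
  define f where "f = rec_nat [] (\<lambda>_ xs. xs @ [pick (set xs)])"
  define a where "a j = pick (set (f j))" for j
  have f: "set (f j) = a ` {..<j}" for j
    by (induction j) (auto simp: f_def a_def lessThan_Suc)
  have sub: "set (f j) \<subseteq> K" for j
    by (induction j) (auto simp: f_def pick)
  show ?thesis
  proof (rule that)
    show "a j \<in> K" for j unfolding a_def using pick sub by blast
    show "\<not> E (a j) (a j')" if "j < j'" for j j'
    proof -
      have "a j \<in> set (f j')" using f that by auto
      then show ?thesis unfolding a_def[of j'] using pick[of "set (f j')"] sub by blast
    qed
  qed
qed

text \<open>All factors of \<open>c 0 \<otimes> \<dots> \<otimes> c (N - 1)\<close> except \<open>c i\<close> lie in the normal subgroup \<open>H i\<close>, so the product lies in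
\<open>H i #> c i\<close>. For the induction, the coset of \<open>i \<ge> N\<close> has to be included: there the product lies in \<open>H i\<close>.\<close>

lemma (in group) partial_products_in_cosets:
  assumes H: "\<And>i :: nat. H i \<lhd> G"
    and c: "\<And>i. c i \<in> carrier G" "\<And>i l. l \<noteq> i \<Longrightarrow> c i \<in> H l"
  shows "\<exists>p\<in>carrier G. \<forall>i<N. \<exists>w\<in>H i. p = w \<otimes> c i"
proof -
  have "\<exists>p\<in>carrier G. (\<forall>i<N. \<exists>w\<in>H i. p = w \<otimes> c i) \<and> (\<forall>i\<ge>N. p \<in> H i)"
  proof (induction N)
    case 0
    show ?case using subgroup.one_closed[OF normal_imp_subgroup[OF H]] by (intro bexI[of _ \<one>]) auto
  next
    case (Suc N)
    then obtain p where p: "p \<in> carrier G" "\<And>i. i < N \<Longrightarrow> \<exists>w\<in>H i. p = w \<otimes> c i" "\<And>i. i \<ge> N \<Longrightarrow> p \<in> H i"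
      by blast
    have sub: "subgroup (H i) G" for i using H by (rule normal_imp_subgroup)
    have "\<exists>w\<in>H i. p \<otimes> c N = w \<otimes> c i" if i: "i < Suc N" for i
    proof (cases "i = N")
      case True
      then show ?thesis using p(3)[of N] by auto
    next
      case False
      then have "i < N" using i by simp
      from p(2)[OF this] obtain w where w: "w \<in> H i" "p = w \<otimes> c i" by blast
      have wG: "w \<in> carrier G" using w(1) subgroup.mem_carrier[OF sub] by blast
      have cN: "c N \<in> H i" using c(2) False by blast
      \<comment> \<open>Normality moves the new factor to the left of c i.\<close>
      have "c i \<otimes> c N \<otimes> inv c i \<in> H i" by (rule normal.inv_op_closed2[OF H c(1) cN])
      then have "w \<otimes> (c i \<otimes> c N \<otimes> inv c i) \<in> H i" using w(1) subgroup.m_closed[OF sub] by blast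
      moreover have "w \<otimes> (c i \<otimes> c N \<otimes> inv c i) \<otimes> c i = p \<otimes> c N"
        using w(2) wG c(1)[of i] c(1)[of N] by (simp add: m_assoc)
      ultimately show ?thesis by metis
    qed
    moreover have "p \<otimes> c N \<in> H i" if "i \<ge> Suc N" for i
      using that p(3)[of i] c(2)[of i N] subgroup.m_closed[OF sub] by auto
    ultimately show ?case using p(1) c(1) by (intro bexI[of _ "p \<otimes> c N"]) auto
  qed
  then show ?thesis by blast
qed

section \<open>Type definable subgroups\<close>

lemma formula_over_mono: "formula_over L A n \<psi> \<Longrightarrow> A \<subseteq> B \<Longrightarrow> formula_over L B n \<psi>"
  unfolding formula_over_def by blast

lemma indiscernible_mono: "indiscernible L M B m s \<Longrightarrow> B' \<subseteq> B \<Longrightarrow> indiscernible L M B' m s"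
  unfolding indiscernible_def using formula_over_mono by blast

lemma ex_env:
  assumes "\<And>v. length (l v) = n" "\<And>v. set (l v) \<subseteq> X" "X \<noteq> {}"
  obtains e where "range e \<subseteq> X" "\<And>v. tup n e v = l v"
proof -
  obtain u where u: "u \<in> X" using assms(3) by blast
  let ?e = "\<lambda>(v, k). if k < n then l v ! k else u"
  have "range ?e \<subseteq> X" using assms(1,2) u by (force simp: subset_iff in_set_conv_nth)
  moreover have "tup n ?e v = l v" for v using assms(1)[of v] by (intro nth_equalityI) (auto simp: tup_def)
  ultimately show ?thesis using that by blast
qed

lemma solutions_UN:
  "I \<noteq> {} \<Longrightarrow> solutions M n (\<Union>i\<in>I. \<Gamma> i) = (\<Inter>i\<in>I. solutions M n (\<Gamma> i))"
  unfolding solutions_def by blast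

lemma map_tup: "map (subst_env e) (map (\<lambda>k. Inl (v, k)) [0..<n]) = tup n e v"
  by (simp add: tup_def comp_def)

lemma map_par: "map (subst_env e) (map Inr xs) = xs"
  by (simp add: comp_def)

lemma definable_holds_tup:
  assumes "formula_over L A n \<psi>" "A \<subseteq> B" "v \<in> V"
  shows "definable L M B (V \<times> {..<n}) (\<lambda>e. holds M \<psi> (tup n e v))"
proof -
  have "set (map (\<lambda>k. Inl (v, k)) [0..<n]) \<subseteq> (V \<times> {..<n}) <+> B" using assms(3) by auto
  then show ?thesis
    using definable_holds[of L A "map (\<lambda>k. Inl (v, k)) [0..<n]" \<psi> "V \<times> {..<n}" B M] assms(1,2)
    unfolding map_tup by simp
qed

locale td_subgroups = saturated_model \<kappa> L C
  for \<kappa> :: "'k rel" and L :: "('f, 'r) lang" and C :: "('f, 'r, 'a) struct" +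
  fixes A :: "'a set" and n :: nat and \<Sigma> :: "('f, 'r, 'a) pfm set" and \<nu> :: "('f, 'r, 'a) pfm"
    and \<Gamma> :: "nat \<Rightarrow> ('f, 'r, 'a) pfm set"
  assumes A: "A \<subseteq> univ C" "small \<kappa> A"
    and G: "type_definable_group L C A n \<Sigma> \<nu>"
    and \<Gamma>: "\<And>i. partial_type L A n (\<Gamma> i)"
    and normal: "\<And>i. solutions C n (\<Gamma> i) \<lhd> td_group C n \<Sigma> \<nu>"
begin

abbreviation grp where "grp \<equiv> td_group C n \<Sigma> \<nu>"
abbreviation sols where "sols p \<equiv> solutions C n p"

sublocale group grp
  using G by (simp add: type_definable_group_def)

lemma carrier_grp: "carrier grp = sols \<Sigma>"
  by (simp add: td_group_def Let_def)

lemma partial_type_\<Sigma>: "partial_type L A n \<Sigma>" and formula_\<nu>: "formula_over L A (3 * n) \<nu>"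
  using G by (auto simp: type_definable_group_def)

lemma solsD: "x \<in> sols p \<Longrightarrow> length x = n" "x \<in> sols p \<Longrightarrow> set x \<subseteq> univ C"
  by (auto simp: solutions_def)

lemma mult_iff:
  assumes "x \<in> carrier grp" "y \<in> carrier grp" "z \<in> carrier grp"
  shows "holds C \<nu> (x @ y @ z) \<longleftrightarrow> z = x \<otimes>\<^bsub>grp\<^esub> y"
proof -
  have ex1: "\<exists>!z. z \<in> sols \<Sigma> \<and> holds C \<nu> (x @ y @ z)"
    using G assms(1,2) unfolding type_definable_group_def carrier_grp by blast
  have "x \<otimes>\<^bsub>grp\<^esub> y = (THE z. z \<in> sols \<Sigma> \<and> holds C \<nu> (x @ y @ z))"
    by (simp add: td_group_def Let_def)
  then show ?thesis using theI'[OF ex1] ex1 assms(3) unfolding carrier_grp by metis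
qed

lemma subgroup_\<Gamma>: "subgroup (sols (\<Gamma> i)) grp"
  using normal by (rule normal_imp_subgroup)

lemma \<Gamma>_carrier: "x \<in> sols (\<Gamma> i) \<Longrightarrow> x \<in> carrier grp"
  using subgroup.mem_carrier[OF subgroup_\<Gamma>] .

text \<open>\<open>x\<close> lies in the translate of \<open>y\<close> by the definable set \<open>Q\<close>. For a finite part \<open>Q\<close> of \<open>\<Gamma> i\<close> this approximates the relation of
lying in the same right coset of the subgroup defined by \<open>\<Gamma> i\<close>, and it is definable, whereas quotients are given only by the
operation on the carrier.\<close>

definition near :: "('f, 'r, 'a) pfm set \<Rightarrow> 'a list \<Rightarrow> 'a list \<Rightarrow> bool" where
  "near Q x y \<longleftrightarrow> (\<exists>z \<in> sols Q. holds C \<nu> (z @ y @ x))"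

lemma near_mult: "w \<in> sols (\<Gamma> i) \<Longrightarrow> Q \<subseteq> \<Gamma> i \<Longrightarrow> y \<in> carrier grp \<Longrightarrow> near Q (w \<otimes>\<^bsub>grp\<^esub> y) y"
  unfolding near_def
proof (rule bexI[of _ w])
  assume *: "w \<in> sols (\<Gamma> i)" "Q \<subseteq> \<Gamma> i" "y \<in> carrier grp"
  show "w \<in> sols Q" using * by (auto simp: solutions_def)
  show "holds C \<nu> (w @ y @ w \<otimes>\<^bsub>grp\<^esub> y)" using * \<Gamma>_carrier mult_iff by blast
qed

lemma definable_holds_\<nu>:
  assumes "length xs = n" "length ys = n" "length zs = n" "set xs \<union> set ys \<union> set zs \<subseteq> V <+> B" "A \<subseteq> B"
  shows "definable L C B V (\<lambda>e. holds C \<nu> (map (subst_env e) xs @ map (subst_env e) ys @ map (subst_env e) zs))"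
  using definable_holds[of L A "xs @ ys @ zs" \<nu> V B C] formula_\<nu> assms by (simp add: numeral_3_eq_3)

lemma definable_near:
  assumes Q: "finite Q" "partial_type L A n Q"
    and xs: "length xs = n" "set xs \<subseteq> V <+> B" and ys: "length ys = n" "set ys \<subseteq> V <+> B"
    and AB: "A \<subseteq> B"
  shows "definable L C B V (\<lambda>e. near Q (map (subst_env e) xs) (map (subst_env e) ys))"
proof -
  let ?V = "{0, 1, 2 :: nat} \<times> {..<n}" and ?W = "{2 :: nat} \<times> {..<n}"
  let ?R = "\<lambda>e. (\<forall>\<psi>\<in>Q. holds C \<psi> (tup n e 2)) \<and> holds C \<nu> (tup n e 2 @ tup n e 1 @ tup n e 0)"
  let ?var = "\<lambda>v. map (\<lambda>k. Inl (v, k)) [0..<n]"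
  have "definable L C A ?V (\<lambda>e. holds C \<nu> (map (subst_env e) (?var 2) @ map (subst_env e) (?var 1) @ map (subst_env e) (?var 0)))"
    by (rule definable_holds_\<nu>) auto
  then have "definable L C A ?V (\<lambda>e. holds C \<nu> (tup n e 2 @ tup n e 1 @ tup n e 0))"
    unfolding map_tup .
  moreover have "definable L C A ?V (\<lambda>e. holds C \<psi> (tup n e 2))" if "\<psi> \<in> Q" for \<psi>
    by (rule definable_holds_tup[of L A]) (use Q(2) that in \<open>auto simp: partial_type_def\<close>)
  then have "definable L C A ?V (\<lambda>e. \<forall>\<psi>\<in>Q. holds C \<psi> (tup n e 2))"
    by (rule definable_Ball[OF Q(1)])
  ultimately have "definable L C A ?V ?R" by (rule definable_Conj[rotated])
  then have "definable L C A (?V - ?W)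
      (\<lambda>e. \<exists>e'. (\<forall>v\<in>?W. e' v \<in> univ C) \<and> (\<forall>v. v \<notin> ?W \<longrightarrow> e' v = e v) \<and> ?R e')"
    by (rule definable_Ex_finite[rotated]) simp
  moreover have "(\<exists>e'. (\<forall>v\<in>?W. e' v \<in> univ C) \<and> (\<forall>v. v \<notin> ?W \<longrightarrow> e' v = e v) \<and> ?R e')
      \<longleftrightarrow> near Q (tup n e 0) (tup n e 1)" (is "?l \<longleftrightarrow> ?r") for e
  proof
    assume ?l
    then obtain e' where "(\<forall>v\<in>?W. e' v \<in> univ C) \<and> (\<forall>v. v \<notin> ?W \<longrightarrow> e' v = e v) \<and> ?R e'" ..
    then have e': "\<forall>v\<in>?W. e' v \<in> univ C" "\<forall>v. v \<notin> ?W \<longrightarrow> e' v = e v" "?R e'" by simp_all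
    have "tup n e' 0 = tup n e 0" "tup n e' 1 = tup n e 1" using e'(2) by (auto simp: tup_def)
    moreover have "set (tup n e' 2) \<subseteq> univ C" using e'(1) unfolding tup_def by auto
    then have "tup n e' 2 \<in> sols Q" using e'(3) unfolding solutions_def by simp
    ultimately show ?r unfolding near_def using e'(3) by (intro bexI[of _ "tup n e' 2"]) simp_all
  next
    assume ?r
    then obtain z where z: "z \<in> sols Q" "holds C \<nu> (z @ tup n e 1 @ tup n e 0)" unfolding near_def by blast
    let ?e = "\<lambda>v. if v \<in> ?W then z ! snd v else e v"
    have "tup n ?e 2 = z" using solsD(1)[OF z(1)] by (intro nth_equalityI) (auto simp: tup_def)
    moreover have "tup n ?e 0 = tup n e 0" "tup n ?e 1 = tup n e 1" by (auto simp: tup_def)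
    ultimately have "?R ?e" using z by (simp add: solutions_def)
    moreover have "\<forall>v\<in>?W. ?e v \<in> univ C"
      using solsD[OF z(1)] by (auto simp: subset_iff)
    ultimately show ?l by (intro exI[of _ ?e]) auto
  qed
  ultimately have "definable L C A (?V - ?W) (\<lambda>e. near Q (tup n e 0) (tup n e 1))" by simp
  moreover define h where "h v = (if fst v = 0 then xs ! snd v else ys ! snd v)" for v :: "nat \<times> nat"
  have "h v \<in> V <+> B" if "v \<in> ?V - ?W" for v
  proof -
    have "snd v < n" using that by auto
    then have "h v \<in> set xs \<union> set ys" using xs(1) ys(1) by (simp add: h_def)
    then show ?thesis using xs(2) ys(2) by blast
  qed
  ultimately have "definable L C B V (\<lambda>e. near Q
      (tup n (\<lambda>v. subst_env e (h v)) 0) (tup n (\<lambda>v. subst_env e (h v)) 1))"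
    by (intro definable_subst[OF _ _ AB]) auto
  moreover have "tup n (\<lambda>v. subst_env e (h v)) 0 = map (subst_env e) xs"
    "tup n (\<lambda>v. subst_env e (h v)) 1 = map (subst_env e) ys" for e
    using xs(1) ys(1) by (auto simp: tup_def h_def intro!: nth_equalityI)
  ultimately show ?thesis by simp
qed

text \<open>The translates are uniformly definable, by one formula in the two tuples with parameters in \<open>A\<close>.\<close>

lemma near_formula:
  assumes Q: "finite Q" "partial_type L A n Q"
  obtains \<psi> where "formula_over L A (n + n) \<psi>"
    "\<And>x y. length x = n \<Longrightarrow> length y = n \<Longrightarrow> holds C \<psi> (x @ y) \<longleftrightarrow> near Q x y"
proof -
  let ?vs = "map (Pair (0::nat)) [0..<n] @ map (Pair 1) [0..<n]"
  let ?var = "\<lambda>v. map (\<lambda>k. Inl (v, k)) [0..<n]"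
  have "definable L C A (set ?vs) (\<lambda>e. near Q (map (subst_env e) (?var 0)) (map (subst_env e) (?var 1)))"
    by (rule definable_near[OF Q]) auto
  moreover have "distinct ?vs" by (auto simp: distinct_map inj_on_def)
  ultimately obtain \<psi> where \<psi>: "formula_over L A (length ?vs) \<psi>"
    "\<And>e. holds C \<psi> (map e ?vs) = near Q (tup n e 0) (tup n e 1)"
    unfolding map_tup by (rule definable_pfm) blast
  show ?thesis
  proof (rule that)
    show "formula_over L A (n + n) \<psi>" using \<psi>(1) by simp
    fix x y :: "'a list" assume len: "length x = n" "length y = n"
    let ?e = "\<lambda>(v, k). (if v = (0::nat) then x else y) ! k"
    have "tup n ?e 0 = x" "tup n ?e 1 = y" using len by (auto simp: tup_def intro!: nth_equalityI)
    moreover have "map ?e ?vs = tup n ?e 0 @ tup n ?e 1" by (simp add: tup_def)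
    ultimately show "holds C \<psi> (x @ y) \<longleftrightarrow> near Q x y" using \<psi>(2)[of ?e] by simp
  qed
qed

text \<open>Compactness: if for each finite part of \<open>\<Gamma> i\<close> the translates of \<open>g\<close> and \<open>g'\<close> meet, then saturation gives a common element
\<open>x = z g = z' g'\<close> with \<open>z\<close> and \<open>z'\<close> in the subgroup itself.\<close>

lemma same_coset_if_near:
  assumes g: "g \<in> carrier grp" "g' \<in> carrier grp"
    and near: "\<And>Q. finite Q \<Longrightarrow> Q \<subseteq> \<Gamma> i \<Longrightarrow> \<exists>x\<in>carrier grp. near Q x g \<and> near Q x g'"
  shows "g \<otimes>\<^bsub>grp\<^esub> inv\<^bsub>grp\<^esub> g' \<in> sols (\<Gamma> i)"
proof -
  let ?A = "A \<union> (set g \<union> set g')"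
  let ?var = "\<lambda>v. map (\<lambda>k. Inl (v, k)) [0..<n]"
  define R where "R \<psi> e \<longleftrightarrow> holds C \<psi> (tup n e (1::nat)) \<and> holds C \<psi> (tup n e 2)" for \<psi> e
  define B where "B = (\<lambda>\<sigma> e. holds C \<sigma> (tup n e (0::nat))) ` \<Sigma> \<union>
    {\<lambda>e. holds C \<nu> (tup n e 1 @ g @ tup n e 0), \<lambda>e. holds C \<nu> (tup n e 2 @ g' @ tup n e 0)}"
  have len: "length g = n" "length g' = n" and gC: "set g \<subseteq> univ C" "set g' \<subseteq> univ C"
    using g solsD[of _ \<Sigma>] unfolding carrier_grp by auto
  have small: "?A \<subseteq> univ C" "small \<kappa> ?A"
    using A gC small_Un[OF A(2) small_finite[of "set g \<union> set g'"]] by auto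
  obtain e where e: "range e \<subseteq> univ C" "\<And>\<psi>. \<psi> \<in> \<Gamma> i \<Longrightarrow> R \<psi> e" "\<And>S. S \<in> B \<Longrightarrow> S e"
  proof (rule realise_family[OF small, of "\<Gamma> i" R B])
    fix \<psi> assume "\<psi> \<in> \<Gamma> i"
    then have "formula_over L A n \<psi>" using \<Gamma> by (auto simp: partial_type_def)
    then show "definable L C ?A UNIV (R \<psi>)"
      unfolding R_def
      by (intro definable_Conj) (rule definable_mono[OF definable_holds_tup[of _ _ _ _ A _ UNIV]]; auto)+
  next
    fix S assume S: "S \<in> B"
    have "definable L C ?A UNIV (\<lambda>e. holds C \<sigma> (tup n e (0::nat)))" if "\<sigma> \<in> \<Sigma>" for \<sigma>
      using that partial_type_\<Sigma>
      by (intro definable_mono[OF definable_holds_tup[of _ A _ _ A _ UNIV]]) (auto simp: partial_type_def)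
    moreover have "definable L C ?A UNIV (\<lambda>e. holds C \<nu> (map (subst_env e) (?var (1::nat)) @
        map (subst_env e) (map Inr g) @ map (subst_env e) (?var 0)))"
      by (rule definable_holds_\<nu>) (use len in auto)
    moreover have "definable L C ?A UNIV (\<lambda>e. holds C \<nu> (map (subst_env e) (?var (2::nat)) @
        map (subst_env e) (map Inr g') @ map (subst_env e) (?var 0)))"
      by (rule definable_holds_\<nu>) (use len in auto)
    ultimately show "definable L C ?A UNIV S"
      using S unfolding B_def map_tup map_par by blast
  next
    fix Q assume "finite Q" "Q \<subseteq> \<Gamma> i"
    then obtain x where x: "x \<in> carrier grp" "near Q x g" "near Q x g'" using near by blast
    then obtain z z' where z: "z \<in> sols Q" "holds C \<nu> (z @ g @ x)" "z' \<in> sols Q" "holds C \<nu> (z' @ g' @ x)"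
      unfolding near_def by blast
    obtain e where e: "range e \<subseteq> univ C" "\<And>v :: nat. tup n e v = (if v = 0 then x else if v = 1 then z else z')"
    proof (rule ex_env[of "\<lambda>v :: nat. if v = 0 then x else if v = 1 then z else z'" n "univ C"])
    qed (use x(1) z solsD univ_nonempty in \<open>auto simp: carrier_grp\<close>)
    have "\<forall>\<psi>\<in>Q. R \<psi> e" using z unfolding R_def e(2) by (simp add: solutions_def)
    moreover have "\<forall>S\<in>B. S e" using z x(1) unfolding B_def carrier_grp by (auto simp: e(2) solutions_def)
    ultimately show "\<exists>e. range e \<subseteq> univ C \<and> (\<forall>\<psi>\<in>Q. R \<psi> e) \<and> (\<forall>S\<in>B. S e)" using e(1) by blast
  qed blast
  let ?x = "tup n e 0" and ?z = "tup n e 1" and ?z' = "tup n e 2"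
  have x: "?x \<in> carrier grp"
    unfolding carrier_grp solutions_def using e(3) set_tup[OF e(1)] by (auto simp: B_def)
  have z: "?z \<in> sols (\<Gamma> i)" "?z' \<in> sols (\<Gamma> i)"
    unfolding solutions_def using e(2) set_tup[OF e(1)] by (auto simp: R_def)
  have zG: "?z \<in> carrier grp" "?z' \<in> carrier grp" using z \<Gamma>_carrier by blast+
  have "holds C \<nu> (?z @ g @ ?x)" "holds C \<nu> (?z' @ g' @ ?x)" using e(3) by (auto simp: B_def)
  then have eq: "?z \<otimes>\<^bsub>grp\<^esub> g = ?z' \<otimes>\<^bsub>grp\<^esub> g'" using mult_iff zG g x by metis
  have "g = inv\<^bsub>grp\<^esub> ?z \<otimes>\<^bsub>grp\<^esub> (?z \<otimes>\<^bsub>grp\<^esub> g)" using zG g by (simp add: m_assoc[symmetric])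
  also have "\<dots> = inv\<^bsub>grp\<^esub> ?z \<otimes>\<^bsub>grp\<^esub> ?z' \<otimes>\<^bsub>grp\<^esub> g'" unfolding eq using zG g by (simp add: m_assoc)
  finally have "g \<otimes>\<^bsub>grp\<^esub> inv\<^bsub>grp\<^esub> g' = inv\<^bsub>grp\<^esub> ?z \<otimes>\<^bsub>grp\<^esub> ?z'"
    using zG g by (metis inv_solve_right inv_closed m_closed)
  then show ?thesis
    using z subgroup.m_closed[OF subgroup_\<Gamma>] subgroup.m_inv_closed[OF subgroup_\<Gamma>] by metis
qed

end

section \<open>Counting cosets in small submodels\<close>

context td_subgroups
begin

text \<open>If \<open>z0\<close> were outside \<open>M\<close>, then every finite part of \<open>\<Sigma>\<close> together with \<open>P\<close> would be realised in \<open>M\<close>, hence by a tuple other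
than \<open>z0\<close>, and saturation would give a second solution in the group. This is how products and quotients of
elements of \<open>M\<close> are seen to lie in \<open>M\<close>, although the carrier is only type definable.\<close>

lemma definable_closure_in_submodel:
  assumes M: "elem_sub L M C" "small \<kappa> (univ M)" "A \<subseteq> univ M"
    and P: "definable L C (univ M) UNIV (\<lambda>e :: nat \<Rightarrow> 'a. P (map e [0..<n]))"
    and z0: "z0 \<in> carrier grp" "P z0"
    and unique: "\<And>z. z \<in> carrier grp \<Longrightarrow> P z \<Longrightarrow> z = z0"
  shows "set z0 \<subseteq> univ M"
proof (rule ccontr)
  assume notM: "\<not> set z0 \<subseteq> univ M"
  let ?t = "\<lambda>e :: nat \<Rightarrow> 'a. map e [0..<n]"
  let ?A = "univ M \<union> set z0"
  have len: "length z0 = n" and z0C: "set z0 \<subseteq> univ C" using z0(1) solsD unfolding carrier_grp by auto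
  have "univ M \<subseteq> univ C" using M(1) by (simp add: elem_sub_def)
  then have small: "?A \<subseteq> univ C" "small \<kappa> ?A"
    using z0C small_Un[OF M(2) small_finite[of "set z0"]] by auto
  have holds_def: "definable L C (univ M) UNIV (\<lambda>e. holds C \<sigma> (?t e))" if "\<sigma> \<in> \<Sigma>" for \<sigma>
  proof -
    have "definable L C (univ M) UNIV (\<lambda>e. holds C \<sigma> (map (subst_env e) (map Inl [0..<n])))"
      by (rule definable_holds[of L A]) (use that partial_type_\<Sigma> M(3) in \<open>auto simp: partial_type_def\<close>)
    then show ?thesis by (simp add: comp_def)
  qed
  obtain e where e: "range e \<subseteq> univ C" "\<And>\<sigma>. \<sigma> \<in> \<Sigma> \<Longrightarrow> holds C \<sigma> (?t e)"
    "\<And>S. S \<in> {\<lambda>e. P (?t e), \<lambda>e. ?t e \<noteq> z0} \<Longrightarrow> S e"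
  proof (rule realise_family[OF small, of \<Sigma> "\<lambda>\<sigma> e. holds C \<sigma> (?t e)" "{\<lambda>e. P (?t e), \<lambda>e. ?t e \<noteq> z0}"])
    show "definable L C ?A UNIV (\<lambda>e. holds C \<sigma> (?t e))" if "\<sigma> \<in> \<Sigma>" for \<sigma>
      by (rule definable_mono[OF holds_def[OF that]]) auto
  next
    fix S assume S: "S \<in> {\<lambda>e. P (?t e), \<lambda>e. ?t e \<noteq> z0}"
    have "definable L C ?A UNIV (\<lambda>e :: nat \<Rightarrow> 'a. \<forall>k\<in>{..<n}. subst_env e (Inl k) = subst_env e (Inr (z0 ! k)))"
      by (intro definable_Ball definable_eq) (use len in auto)
    then have "definable L C ?A UNIV (\<lambda>e :: nat \<Rightarrow> 'a. \<not> (\<forall>k\<in>{..<n}. e k = z0 ! k))"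
      by (intro definable_Neg) simp
    moreover have "(\<forall>k\<in>{..<n}. e k = z0 ! k) \<longleftrightarrow> ?t e = z0" for e
      using len by (auto simp: list_eq_iff_nth_eq)
    ultimately have "definable L C ?A UNIV (\<lambda>e. ?t e \<noteq> z0)" by simp
    moreover have "definable L C ?A UNIV (\<lambda>e. P (?t e))" by (rule definable_mono[OF P]) auto
    ultimately show "definable L C ?A UNIV S" using S by auto
  next
    fix Q assume Q: "finite Q" "Q \<subseteq> \<Sigma>"
    obtain u where u: "u \<in> univ C" using univ_nonempty by blast
    let ?e = "\<lambda>k. if k < n then z0 ! k else u"
    let ?R = "\<lambda>e. (\<forall>\<sigma>\<in>Q. holds C \<sigma> (?t e)) \<and> P (?t e)"
    have "definable L C (univ M) UNIV (\<lambda>e. \<forall>\<sigma>\<in>Q. holds C \<sigma> (?t e))"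
      by (rule definable_Ball[OF Q(1)]) (use holds_def Q(2) in blast)
    then have def_R: "definable L C (univ M) UNIV ?R" by (rule definable_Conj[OF _ P])
    have t: "?t ?e = z0" using len by (auto intro: nth_equalityI)
    have "\<forall>\<sigma>\<in>Q. holds C \<sigma> z0" using z0(1) Q(2) unfolding carrier_grp solutions_def by blast
    then have "?R ?e" unfolding t using z0(2) by blast
    moreover have "range ?e \<subseteq> univ C" using z0C len u by auto
    ultimately obtain e' where e': "range e' \<subseteq> univ M" "?R e'"
      using tarski_vaught[OF M(1) def_R] by blast
    have "set (?t e') \<subseteq> univ M" using e'(1) by auto
    then have "?t e' \<noteq> z0" using notM by blast
    then show "\<exists>e. range e \<subseteq> univ C \<and> (\<forall>\<sigma>\<in>Q. holds C \<sigma> (?t e)) \<and> (\<forall>S\<in>{\<lambda>e. P (?t e), \<lambda>e. ?t e \<noteq> z0}. S e)"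
      using e' \<open>univ M \<subseteq> univ C\<close> by (intro exI[of _ e']) auto
  qed blast
  have "?t e \<in> carrier grp"
    unfolding carrier_grp solutions_def using e(1,2) by auto
  then show False using unique e(3) by blast
qed

lemma submodel_closed:
  assumes M: "elem_sub L M C" "small \<kappa> (univ M)" "A \<subseteq> univ M"
    and xy: "x \<in> carrier grp" "y \<in> carrier grp" "set x \<subseteq> univ M" "set y \<subseteq> univ M"
  shows "set (x \<otimes>\<^bsub>grp\<^esub> y) \<subseteq> univ M" "set (x \<otimes>\<^bsub>grp\<^esub> inv\<^bsub>grp\<^esub> y) \<subseteq> univ M"
proof -
  have len: "length x = n" "length y = n" using xy solsD unfolding carrier_grp by auto
  have var: "map (subst_env e) (map Inl [0..<n]) = map e [0..<n]" for e :: "nat \<Rightarrow> 'a"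
    by (simp add: comp_def)
  have "definable L C (univ M) UNIV (\<lambda>e :: nat \<Rightarrow> 'a. holds C \<nu> (map (subst_env e) (map Inr x) @
      map (subst_env e) (map Inr y) @ map (subst_env e) (map Inl [0..<n])))"
    by (rule definable_holds_\<nu>) (use len xy M(3) in auto)
  then have 1: "definable L C (univ M) UNIV (\<lambda>e :: nat \<Rightarrow> 'a. holds C \<nu> (x @ y @ map e [0..<n]))"
    unfolding var map_par .
  show "set (x \<otimes>\<^bsub>grp\<^esub> y) \<subseteq> univ M"
  proof (rule definable_closure_in_submodel[OF M, where P = "\<lambda>z. holds C \<nu> (x @ y @ z)", OF 1])
    show p: "x \<otimes>\<^bsub>grp\<^esub> y \<in> carrier grp" using xy by simp
    show "holds C \<nu> (x @ y @ x \<otimes>\<^bsub>grp\<^esub> y)" unfolding mult_iff[OF xy(1,2) p] ..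
    show "z = x \<otimes>\<^bsub>grp\<^esub> y" if "z \<in> carrier grp" "holds C \<nu> (x @ y @ z)" for z
      using that(2) unfolding mult_iff[OF xy(1,2) that(1)] .
  qed
  have "definable L C (univ M) UNIV (\<lambda>e :: nat \<Rightarrow> 'a. holds C \<nu> (map (subst_env e) (map Inl [0..<n]) @
      map (subst_env e) (map Inr y) @ map (subst_env e) (map Inr x)))"
    by (rule definable_holds_\<nu>) (use len xy M(3) in auto)
  then have 2: "definable L C (univ M) UNIV (\<lambda>e :: nat \<Rightarrow> 'a. holds C \<nu> (map e [0..<n] @ y @ x))"
    unfolding var map_par .
  have eq: "x = z \<otimes>\<^bsub>grp\<^esub> y \<longleftrightarrow> z = x \<otimes>\<^bsub>grp\<^esub> inv\<^bsub>grp\<^esub> y" if "z \<in> carrier grp" for z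
    by (rule inv_solve_right[OF that xy(1,2), symmetric])
  show "set (x \<otimes>\<^bsub>grp\<^esub> inv\<^bsub>grp\<^esub> y) \<subseteq> univ M"
  proof (rule definable_closure_in_submodel[OF M, where P = "\<lambda>z. holds C \<nu> (z @ y @ x)", OF 2])
    show d: "x \<otimes>\<^bsub>grp\<^esub> inv\<^bsub>grp\<^esub> y \<in> carrier grp" using xy by simp
    show "holds C \<nu> (x \<otimes>\<^bsub>grp\<^esub> inv\<^bsub>grp\<^esub> y @ y @ x)" 
      by (rule iffD2[OF mult_iff[OF d xy(2,1)] iffD2[OF eq[OF d] refl]])
    show "z = x \<otimes>\<^bsub>grp\<^esub> inv\<^bsub>grp\<^esub> y" if "z \<in> carrier grp" "holds C \<nu> (z @ y @ x)" for z
      by (rule iffD1[OF eq[OF that(1)] iffD1[OF mult_iff[OF that(1) xy(2,1)] that(2)]])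
  qed
qed

abbreviation "others i \<equiv> (\<Union>l \<in> - {i}. \<Gamma> l)"

lemma sols_others: "sols (others i) = (\<Inter>l \<in> - {i}. sols (\<Gamma> l))"
proof (rule solutions_UN)
  have "Suc i \<in> - {i}" by simp
  then show "- {i} \<noteq> {}" by blast
qed

lemma sols_othersI: "(\<And>l. l \<noteq> i \<Longrightarrow> x \<in> sols (\<Gamma> l)) \<Longrightarrow> x \<in> sols (others i)"
  unfolding sols_others by (rule INT_I) simp

lemma sols_othersD: "x \<in> sols (others i) \<Longrightarrow> l \<noteq> i \<Longrightarrow> x \<in> sols (\<Gamma> l)"
  unfolding sols_others by (erule INT_D) simp

lemma others_carrier: "x \<in> sols (others i) \<Longrightarrow> x \<in> carrier grp"
  by (rule \<Gamma>_carrier[OF sols_othersD[OF _ Suc_n_not_n]])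

lemma sols_all: "sols (\<Union>i. \<Gamma> i) = sols (others i) \<inter> sols (\<Gamma> i)"
  unfolding solutions_def by auto

lemma others_mult:
  assumes "x \<in> sols (others i)" "y \<in> sols (others i)"
  shows "x \<otimes>\<^bsub>grp\<^esub> y \<in> sols (others i)"
proof (rule sols_othersI)
  fix l assume l: "l \<noteq> i"
  show "x \<otimes>\<^bsub>grp\<^esub> y \<in> sols (\<Gamma> l)"
    by (rule subgroup.m_closed[OF subgroup_\<Gamma> sols_othersD[OF assms(1) l] sols_othersD[OF assms(2) l]])
qed

lemma others_quot:
  assumes "x \<in> sols (others i)" "y \<in> sols (others i)"
  shows "x \<otimes>\<^bsub>grp\<^esub> inv\<^bsub>grp\<^esub> y \<in> sols (others i)"
proof (rule sols_othersI)
  fix l assume l: "l \<noteq> i"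
  show "x \<otimes>\<^bsub>grp\<^esub> inv\<^bsub>grp\<^esub> y \<in> sols (\<Gamma> l)"
    by (rule subgroup.m_closed[OF subgroup_\<Gamma> sols_othersD[OF assms(1) l]
          subgroup.m_inv_closed[OF subgroup_\<Gamma> sols_othersD[OF assms(2) l]]])
qed

lemma partial_type_UN: "partial_type L A n (\<Union>i\<in>I. \<Gamma> i)"
  using \<Gamma> unfolding partial_type_def by blast

text \<open>The operation of the submodel is described by a definite description that ranges over \<open>M\<close>. It agrees with the operation of the monster model because the
product is in \<open>M\<close>.\<close>

lemma submodel_mult:
  assumes M: "elem_sub L M C" "small \<kappa> (univ M)" "A \<subseteq> univ M"
    and xy: "x \<in> solutions M n (others i)" "y \<in> solutions M n (others i)"
  shows "x \<otimes>\<^bsub>td_group M n (others i) \<nu>\<^esub> y = x \<otimes>\<^bsub>grp\<^esub> y"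
proof -
  have sol: "solutions M n (others i) = {z \<in> sols (others i). set z \<subseteq> univ M}"
    by (rule elem_sub_solutions[OF M(1) partial_type_UN M(3)])
  have x: "x \<in> sols (others i)" "set x \<subseteq> univ M" and y: "y \<in> sols (others i)" "set y \<subseteq> univ M"
    using xy unfolding sol by auto
  have G: "x \<in> carrier grp" "y \<in> carrier grp" using x y others_carrier by blast+
  have p: "x \<otimes>\<^bsub>grp\<^esub> y \<in> solutions M n (others i)"
    unfolding sol using others_mult[OF x(1) y(1)] submodel_closed(1)[OF M G x(2) y(2)] by blast
  have holds: "holds M \<nu> (x @ y @ z) \<longleftrightarrow> z = x \<otimes>\<^bsub>grp\<^esub> y" if z: "z \<in> solutions M n (others i)" for z
  proof -
    have z': "z \<in> sols (others i)" "set z \<subseteq> univ M" using z unfolding sol by auto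
    have "formula_over L A (length (x @ y @ z)) \<nu>"
      using formula_\<nu> solsD(1)[OF x(1)] solsD(1)[OF y(1)] solsD(1)[OF z'(1)] by (simp add: numeral_3_eq_3)
    then have "holds M \<nu> (x @ y @ z) = holds C \<nu> (x @ y @ z)"
      by (rule elem_sub_holds[OF M(1) _ M(3)]) (use x y z' in auto)
    then show ?thesis using mult_iff[OF G others_carrier[OF z'(1)]] by simp
  qed
  have "x \<otimes>\<^bsub>td_group M n (others i) \<nu>\<^esub> y = (THE z. z \<in> solutions M n (others i) \<and> holds M \<nu> (x @ y @ z))"
    by (simp add: td_group_def Let_def)
  also have "\<dots> = x \<otimes>\<^bsub>grp\<^esub> y"
    by (rule the_equality) (use holds p in blast)+
  finally show ?thesis .
qed

lemma submodel_coset_subset: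
  assumes M: "elem_sub L M C" "small \<kappa> (univ M)" "A \<subseteq> univ M"
    and g: "g \<in> solutions M n (others i)" "g' \<in> solutions M n (others i)"
    and quot: "g \<otimes>\<^bsub>grp\<^esub> inv\<^bsub>grp\<^esub> g' \<in> sols (\<Gamma> i)"
  shows "solutions M n (\<Union>i. \<Gamma> i) #>\<^bsub>td_group M n (others i) \<nu>\<^esub> g
    \<subseteq> solutions M n (\<Union>i. \<Gamma> i) #>\<^bsub>td_group M n (others i) \<nu>\<^esub> g'"
proof
  let ?H = "solutions M n (\<Union>i. \<Gamma> i)" and ?K = "solutions M n (others i)"
  have K: "?K = {z \<in> sols (others i). set z \<subseteq> univ M}"
    by (rule elem_sub_solutions[OF M(1) partial_type_UN M(3)])
  have H: "?H = {z \<in> sols (others i) \<inter> sols (\<Gamma> i). set z \<subseteq> univ M}"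
    unfolding sols_all[of i, symmetric] by (rule elem_sub_solutions[OF M(1) partial_type_UN M(3)])
  have gK: "g \<in> sols (others i)" "set g \<subseteq> univ M" "g' \<in> sols (others i)" "set g' \<subseteq> univ M"
    using g unfolding K by auto
  have gG: "g \<in> carrier grp" "g' \<in> carrier grp" by (rule others_carrier[OF gK(1)], rule others_carrier[OF gK(3)])
  let ?d = "g \<otimes>\<^bsub>grp\<^esub> inv\<^bsub>grp\<^esub> g'"
  have d: "?d \<in> sols (others i)" "set ?d \<subseteq> univ M"
    by (rule others_quot[OF gK(1,3)], rule submodel_closed(2)[OF M gG gK(2,4)])
  fix x assume "x \<in> ?H #>\<^bsub>td_group M n (others i) \<nu>\<^esub> g"
  then obtain h where h: "h \<in> ?H" "x = h \<otimes>\<^bsub>td_group M n (others i) \<nu>\<^esub> g" unfolding r_coset_def by (elim UN_E singletonE)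
  have hH: "h \<in> sols (others i)" "h \<in> sols (\<Gamma> i)" "set h \<subseteq> univ M" using h(1) unfolding H by auto
  have hG: "h \<in> carrier grp" by (rule others_carrier[OF hH(1)])
  have dG: "?d \<in> carrier grp" using gG by simp
  have hd: "h \<otimes>\<^bsub>grp\<^esub> ?d \<in> ?H"
    unfolding H using others_mult[OF hH(1) d(1)] subgroup.m_closed[OF subgroup_\<Gamma> hH(2) quot]
      submodel_closed(1)[OF M hG dG hH(3) d(2)] by simp
  moreover have "x = (h \<otimes>\<^bsub>grp\<^esub> ?d) \<otimes>\<^bsub>td_group M n (others i) \<nu>\<^esub> g'"
  proof -
    have sub: "?H \<subseteq> ?K" unfolding H K by auto
    have "x = h \<otimes>\<^bsub>grp\<^esub> g" unfolding h(2) by (rule submodel_mult[OF M subsetD[OF sub h(1)] g(1)])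
    also have "\<dots> = (h \<otimes>\<^bsub>grp\<^esub> ?d) \<otimes>\<^bsub>grp\<^esub> g'" using hG gG by (simp add: m_assoc)
    also have "\<dots> = (h \<otimes>\<^bsub>grp\<^esub> ?d) \<otimes>\<^bsub>td_group M n (others i) \<nu>\<^esub> g'"
      by (rule submodel_mult[OF M subsetD[OF sub hd] g(2), symmetric])
    finally show ?thesis .
  qed
  ultimately show "x \<in> ?H #>\<^bsub>td_group M n (others i) \<nu>\<^esub> g'"
    unfolding r_coset_def by (intro UN_I[of "h \<otimes>\<^bsub>grp\<^esub> ?d"]) simp_all
qed

text \<open>Record for each \<open>g\<close> which points of the finite sets \<open>F\<close> lie in the translates of \<open>g\<close>. Two elements with the same record are in the
same coset by compactness, since for every \<open>Q\<close> their translates share a point of \<open>F\<close>. So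
there are at most as many cosets as subsets of a small set \<open>?S\<close>, and \<open>Pow (Pow ?S)\<close> is still
small, which bounds the index strictly.\<close>

lemma bounded_if_translates_met:
  assumes cover: "\<And>Q. finite Q \<Longrightarrow> Q \<subseteq> \<Gamma> i \<Longrightarrow>
    \<exists>F. finite F \<and> F \<subseteq> sols (others i) \<and> (\<forall>g\<in>sols (others i). \<exists>a\<in>F. near Q a g)"
  shows "bounded_index \<kappa> L C A n \<nu> (others i) (\<Union>i. \<Gamma> i)"
proof
  assume unb: "unbounded_index \<kappa> L C A n \<nu> (others i) (\<Union>i. \<Gamma> i)"
  let ?I = "{Q. finite Q \<and> Q \<subseteq> \<Gamma> i}"
  let ?cov = "\<lambda>Q as. set as \<subseteq> sols (others i) \<and> (\<forall>g\<in>sols (others i). \<exists>a\<in>set as. near Q a g)"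
  have "\<forall>Q\<in>?I. \<exists>as. ?cov Q as"
  proof
    fix Q assume "Q \<in> ?I"
    then have "finite Q" "Q \<subseteq> \<Gamma> i" by simp_all
    from cover[OF this] obtain F where F: "finite F" "F \<subseteq> sols (others i)"
      "\<forall>g\<in>sols (others i). \<exists>a\<in>F. near Q a g" by (elim exE conjE)
    from finite_list[OF F(1)] obtain as where "set as = F" ..
    then show "\<exists>as. ?cov Q as" using F(2,3) by (intro exI[of _ as]) simp
  qed
  from bchoice[OF this] obtain as where as: "\<forall>Q\<in>?I. ?cov Q (as Q)" ..
  \<comment> \<open>Numbering the points of each F gives a small index set for all of them, with no bound on unions of small families.\<close>
  let ?S = "?I \<times> (UNIV :: nat set)"
  define h where "h g = {(Q, j). Q \<in> ?I \<and> j < length (as Q) \<and> near Q (as Q ! j) g}" for g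
  have quot: "g \<otimes>\<^bsub>grp\<^esub> inv\<^bsub>grp\<^esub> g' \<in> sols (\<Gamma> i)"
    if g: "g \<in> sols (others i)" "g' \<in> sols (others i)" "h g = h g'" for g g'
  proof (rule same_coset_if_near)
    show "g \<in> carrier grp" "g' \<in> carrier grp" by (rule others_carrier[OF g(1)], rule others_carrier[OF g(2)])
    fix Q assume "finite Q" "Q \<subseteq> \<Gamma> i"
    then have Q: "Q \<in> ?I" by simp
    obtain j where j: "j < length (as Q)" "near Q (as Q ! j) g"
      using bspec[OF as Q] g(1) by (metis in_set_conv_nth)
    then have "(Q, j) \<in> h g" using Q unfolding h_def by simp
    then have "near Q (as Q ! j) g'" unfolding g(3) unfolding h_def by simp
    moreover have "as Q ! j \<in> sols (others i)" using bspec[OF as Q] j(1) by auto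
    then have "as Q ! j \<in> carrier grp" by (rule others_carrier)
    ultimately show "\<exists>x\<in>carrier grp. near Q x g \<and> near Q x g'" using j(2) by (intro bexI conjI)
  qed
  have "small \<kappa> (\<Gamma> i)" by (rule small_partial_type[OF small_lang A(2) \<Gamma>])
  then have "small \<kappa> (Pow (\<Gamma> i))" by (rule small_Pow[OF strong_limit])
  then have "small \<kappa> ?I" by (rule small_subset) blast
  then have "small \<kappa> (Pow (Pow ?S))" by (intro small_Pow strong_limit small_Times small_nat)
  then have lt: "|Pow (Pow ?S)| <o \<kappa>" by (simp add: small_def)
  from iffD1[OF internalize_card_of_ordLeq ordLess_imp_ordLeq[OF this]]
  obtain X :: "'k set" where X: "|Pow (Pow ?S)| =o |X|" by (elim exE conjE)
  have "|X| <o \<kappa>" using ordIso_ordLess_trans[OF ordIso_symmetric[OF X] lt] .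
  with card_of_Card_order[of X] have "Card_order |X| \<and> |X| <o \<kappa>" by (rule conjI)
  from unb[unfolded unbounded_index_def, rule_format, OF this] obtain M where M: "elem_sub L M C" "small \<kappa> (univ M)" "A \<subseteq> univ M"
    and big: "|X| \<le>o |rcosets\<^bsub>td_group M n (others i) \<nu>\<^esub> (solutions M n (\<Union>i. \<Gamma> i))|"
    by (elim exE conjE)
  let ?K = "solutions M n (others i)"
  let ?coset = "\<lambda>g. solutions M n (\<Union>i. \<Gamma> i) #>\<^bsub>td_group M n (others i) \<nu>\<^esub> g"
  let ?cosets = "rcosets\<^bsub>td_group M n (others i) \<nu>\<^esub> (solutions M n (\<Union>i. \<Gamma> i))"
  have K: "?K = {z \<in> sols (others i). set z \<subseteq> univ M}"
    by (rule elem_sub_solutions[OF M(1) partial_type_UN M(3)])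
  have cosets: "?cosets = ?coset ` ?K"
    by (auto simp: RCOSETS_def td_group_def Let_def)
  have same: "?coset g = ?coset g'" if "g \<in> ?K" "g' \<in> ?K" "h g = h g'" for g g'
  proof -
    have "g \<in> sols (others i)" "g' \<in> sols (others i)" using that(1,2) unfolding K by auto
    note sols = this
    show ?thesis
      by (rule subset_antisym)
        (rule submodel_coset_subset[OF M that(1,2) quot[OF sols that(3)]],
         rule submodel_coset_subset[OF M that(2,1) quot[OF sols(2,1) that(3)[symmetric]]])
  qed
  have "\<forall>Y\<in>?cosets. \<exists>g. g \<in> ?K \<and> Y = ?coset g" unfolding cosets by auto
  from bchoice[OF this] obtain r where r: "\<forall>Y\<in>?cosets. r Y \<in> ?K \<and> Y = ?coset (r Y)" ..
  have "inj_on (\<lambda>Y. h (r Y)) ?cosets"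
  proof (rule inj_onI)
    fix Y Z assume Y: "Y \<in> ?cosets" and Z: "Z \<in> ?cosets" and eq: "h (r Y) = h (r Z)"
    have "?coset (r Y) = ?coset (r Z)" by (rule same) (use bspec[OF r Y] bspec[OF r Z] eq in simp_all)
    then show "Y = Z" using bspec[OF r Y] bspec[OF r Z] by metis
  qed
  moreover have "(\<lambda>Y. h (r Y)) ` ?cosets \<subseteq> Pow ?S" by (auto simp: h_def)
  ultimately have "|?cosets| \<le>o |Pow ?S|" unfolding card_of_ordLeq[symmetric] by (intro exI conjI)
  then have "|X| \<le>o |Pow ?S|" by (rule ordLeq_transitive[OF big])
  then have "|Pow (Pow ?S)| \<le>o |Pow ?S|" by (rule ordIso_ordLeq_trans[OF X])
  with card_of_Pow[of "Pow ?S"] show False by (simp add: not_ordLess_ordLeq)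
qed

end

section \<open>The array refuting strong dependence\<close>

lemma tup_subarray:
  assumes "\<And>j. length (b i j) = n"
  shows "tup n (subarray (\<lambda>i j k. if k < n then b i j ! k else u) s) (i, j) = b i (s (i, j))"
  using assms by (intro nth_equalityI) (auto simp: tup_def subarray_def)

context td_subgroups
begin

text \<open>An array that is mutually indiscernible over \<open>A\<close>, with rows in the larger groups, and with the first two entries of row \<open>i\<close>
in different cosets modulo \<open>\<Gamma> i\<close>.\<close>

definition separating_array :: "(nat \<Rightarrow> nat \<Rightarrow> 'a list) \<Rightarrow> bool" where
  "separating_array c \<longleftrightarrow>
     (\<forall>i j. c i j \<in> sols (others i)) \<and>
     (\<forall>i. c i 0 \<otimes>\<^bsub>grp\<^esub> inv\<^bsub>grp\<^esub> c i 1 \<notin> sols (\<Gamma> i)) \<and>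
     (\<forall>i0 p. set p \<subseteq> A \<longrightarrow>
        indiscernible L C (A \<union> (\<Union>i \<in> - {i0}. \<Union>j. set (c i j))) (n + length p) (\<lambda>j. c i0 j @ p))"

text \<open>The sequences \<open>b i\<close> are separated by the relation \<open>near (Q i)\<close>, which is definable, so that the separation survives in the
indiscernible array.\<close>

lemma ex_separating_array:
  fixes b :: "nat \<Rightarrow> nat \<Rightarrow> 'a list"
  assumes b: "\<And>i j. b i j \<in> sols (others i)"
    and Q: "\<And>i. finite (Q i)" "\<And>i. Q i \<subseteq> \<Gamma> i"
    and far: "\<And>i j j'. j < j' \<Longrightarrow> \<not> near (Q i) (b i j) (b i j')"
  obtains c where "separating_array c"
proof -
  obtain u where u: "u \<in> univ C" using univ_nonempty by auto
  define a where "a = (\<lambda>i j k. if k < n then b i j ! k else u)"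
  have len: "length (b i j) = n" for i j by (rule solsD(1)[OF b])
  have aC: "a i j k \<in> univ C" for i j k
  proof (cases "k < n")
    case True
    then have "b i j ! k \<in> set (b i j)" using len by simp
    then show ?thesis using True solsD(2)[OF b] unfolding a_def by auto
  qed (simp add: a_def u)
  have sub: "tup n (subarray a s) (i, j) = b i (s (i, j))" for s i j
    unfolding a_def by (rule tup_subarray[OF len])
  show ?thesis
  proof (rule mutually_indiscernible_array[OF A aC])
    fix e assume e: "range e \<subseteq> univ C"
      and transfer: "\<And>R i. definable L C A UNIV R \<Longrightarrow> (\<And>s. s (i, 0) < s (i, 1) \<Longrightarrow> R (subarray a s)) \<Longrightarrow> R e"
      and indisc: "\<And>i0 p. set p \<subseteq> A \<Longrightarrow>
        indiscernible L C (A \<union> (\<Union>i \<in> - {i0}. \<Union>j. set (tup n e (i, j)))) (n + length p)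
          (\<lambda>j. tup n e (i0, j) @ p)"
    define c where "c i j = tup n e (i, j)" for i j
    have c: "c i j \<in> sols (others i)" for i j
    proof -
      have "holds C \<psi> (c i j)" if \<psi>: "\<psi> \<in> others i" for \<psi>
        unfolding c_def
      proof (rule transfer)
        have "formula_over L A n \<psi>" using partial_type_UN[of "- {i}"] \<psi> unfolding partial_type_def by (rule bspec)
        then show "definable L C A UNIV (\<lambda>e. holds C \<psi> (tup n e (i, j)))"
          by (intro definable_mono[OF definable_holds_tup[of L A n \<psi> A _ UNIV]]) auto
        show "holds C \<psi> (tup n (subarray a s) (i, j))" for s
          using b[of i "s (i, j)"] \<psi> unfolding sub solutions_def by (simp only: mem_Collect_eq)
      qed
      then show ?thesis using set_tup[OF e, of n] unfolding solutions_def c_def by auto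
    qed
    have far_c: "\<not> near (Q i) (c i 0) (c i 1)" for i
      unfolding c_def
    proof (rule transfer)
      have "partial_type L A n (Q i)" using \<Gamma> Q(2) unfolding partial_type_def by (meson subsetD)
      then have "definable L C A UNIV (\<lambda>e. near (Q i) (map (subst_env e) (map (\<lambda>k. Inl ((i, 0), k)) [0..<n]))
          (map (subst_env e) (map (\<lambda>k. Inl ((i, 1), k)) [0..<n])))"
        by (intro definable_near[OF Q(1)]) auto
      then show "definable L C A UNIV (\<lambda>e. \<not> near (Q i) (tup n e (i, 0)) (tup n e (i, 1)))"
        unfolding map_tup by (rule definable_Neg)
      show "\<not> near (Q i) (tup n (subarray a s) (i, 0)) (tup n (subarray a s) (i, 1))" if "s (i, 0) < s (i, 1)" for s
        unfolding sub by (rule far[OF that])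
    qed
    have "c i 0 \<otimes>\<^bsub>grp\<^esub> inv\<^bsub>grp\<^esub> c i 1 \<notin> sols (\<Gamma> i)" for i
    proof
      have G: "c i 0 \<in> carrier grp" "c i 1 \<in> carrier grp" by (rule others_carrier[OF c])+
      assume "c i 0 \<otimes>\<^bsub>grp\<^esub> inv\<^bsub>grp\<^esub> c i 1 \<in> sols (\<Gamma> i)"
      then have "near (Q i) (c i 0 \<otimes>\<^bsub>grp\<^esub> inv\<^bsub>grp\<^esub> c i 1 \<otimes>\<^bsub>grp\<^esub> c i 1) (c i 1)"
        by (rule near_mult[OF _ Q(2) G(2)])
      also have "c i 0 \<otimes>\<^bsub>grp\<^esub> inv\<^bsub>grp\<^esub> c i 1 \<otimes>\<^bsub>grp\<^esub> c i 1 = c i 0" using G by (simp add: m_assoc)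
      finally show False using far_c[of i] by simp
    qed
    moreover have "indiscernible L C (A \<union> (\<Union>i \<in> - {i0}. \<Union>j. set (c i j))) (n + length p) (\<lambda>j. c i0 j @ p)"
      if "set p \<subseteq> A" for i0 p
      unfolding c_def by (rule indisc[OF that])
    ultimately have "separating_array c" unfolding separating_array_def using c by simp
    then show ?thesis by (rule that)
  qed
qed

text \<open>The formulas that refute strong dependence define \<open>near (Q i)\<close>, where \<open>Q i\<close> is a finite part of \<open>\<Gamma> i\<close> for which the translates of \<open>c i 0\<close> and
\<open>c i 1\<close> are disjoint; it exists by compactness, as the two entries are in different cosets. A finite part of the type
is realised by a product of entries \<open>c i 0\<close>, which is in the coset of each of its factors.\<close>

lemma not_strongly_dependent:
  assumes "separating_array c"
  shows "\<not> strongly_dependent L C"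
proof -
  have c: "c i j \<in> sols (others i)" for i j using assms by (simp add: separating_array_def)
  have sep: "c i 0 \<otimes>\<^bsub>grp\<^esub> inv\<^bsub>grp\<^esub> c i 1 \<notin> sols (\<Gamma> i)" for i using assms by (simp add: separating_array_def)
  have indisc: "indiscernible L C (A \<union> (\<Union>i \<in> - {i0}. \<Union>j. set (c i j))) (n + length p) (\<lambda>j. c i0 j @ p)"
    if "set p \<subseteq> A" for i0 p using assms that by (simp add: separating_array_def)
  have cG: "c i j \<in> carrier grp" for i j by (rule others_carrier[OF c])
  have "\<exists>Q. finite Q \<and> Q \<subseteq> \<Gamma> i \<and> \<not> (\<exists>x\<in>carrier grp. near Q x (c i 0) \<and> near Q x (c i 1))" for i
  proof (rule ccontr)
    assume neg: "\<not> ?thesis"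
    have "c i 0 \<otimes>\<^bsub>grp\<^esub> inv\<^bsub>grp\<^esub> c i 1 \<in> sols (\<Gamma> i)"
    proof (rule same_coset_if_near[OF cG cG])
      fix Q assume "finite Q" "Q \<subseteq> \<Gamma> i"
      then show "\<exists>x\<in>carrier grp. near Q x (c i 0) \<and> near Q x (c i 1)" using neg by simp
    qed
    then show False using sep by simp
  qed
  then obtain Q where Q: "\<And>i. finite (Q i)" "\<And>i. Q i \<subseteq> \<Gamma> i"
    "\<And>i x. x \<in> carrier grp \<Longrightarrow> near (Q i) x (c i 0) \<Longrightarrow> \<not> near (Q i) x (c i 1)" by metis
  have "\<exists>\<psi>. formula_over L A (n + n) \<psi> \<and>
    (\<forall>x y. length x = n \<longrightarrow> length y = n \<longrightarrow> holds C \<psi> (x @ y) = near (Q i) x y)" for i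
  proof -
    have "partial_type L A n (Q i)" using \<Gamma> Q(2) unfolding partial_type_def by (meson subsetD)
    from near_formula[OF Q(1) this] show ?thesis by metis
  qed
  then obtain \<psi> where \<psi>: "\<And>i. formula_over L A (n + n) (\<psi> i)"
    "\<And>i x y. length x = n \<Longrightarrow> length y = n \<Longrightarrow> holds C (\<psi> i) (x @ y) = near (Q i) x y" by metis
  define \<phi> where "\<phi> i = fst (\<psi> i)" for i
  define p where "p i = snd (\<psi> i)" for i
  let ?m = "\<lambda>i. n + length (p i)"
  let ?a = "\<lambda>i j. c i j @ p i"
  have len: "length (c i j) = n" for i j by (rule solsD(1)[OF c])
  have pA: "set (p i) \<subseteq> A" for i using \<psi>(1)[of i] by (simp add: formula_over_def p_def)
  have "wf_fm L (\<phi> i) \<and> fv (\<phi> i) \<subseteq> {..<n + ?m i}" for i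
    using \<psi>(1)[of i] by (simp add: formula_over_def \<phi>_def p_def add.assoc)
  moreover have "indiscernible_array L C {} ?m ?a"
    unfolding indiscernible_array_def
  proof
    fix i0
    show "indiscernible L C ({} \<union> (\<Union>i \<in> - {i0}. \<Union>j. set (?a i j))) (?m i0) (?a i0)"
    proof (rule indiscernible_mono[OF indisc[OF pA]])
      show "{} \<union> (\<Union>i \<in> - {i0}. \<Union>j. set (?a i j)) \<subseteq> A \<union> (\<Union>i \<in> - {i0}. \<Union>j. set (c i j))"
        using pA by auto
    qed
  qed
  moreover have "consistent_in C n (\<Union>i. {(\<phi> i, ?a i 0), (Neg (\<phi> i), ?a i 1)})"
    unfolding consistent_in_def
  proof (intro allI impI)
    fix q assume q: "q \<subseteq> (\<Union>i. {(\<phi> i, ?a i 0), (Neg (\<phi> i), ?a i 1)})" "finite q"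
    \<comment> \<open>The union is written as an image, so that a finite subset involves finitely many rows.\<close>
    let ?f = "\<lambda>(i, b). if b then (\<phi> i, ?a i 0) else (Neg (\<phi> i), ?a i 1)"
    have "q \<subseteq> ?f ` UNIV"
    proof
      fix \<theta> assume "\<theta> \<in> q"
      then obtain i where "\<theta> = ?f (i, True) \<or> \<theta> = ?f (i, False)" using q(1) by auto
      then show "\<theta> \<in> ?f ` UNIV" by (elim disjE) (rule image_eqI[OF _ UNIV_I], assumption)+
    qed
    from finite_subset_image[OF q(2) this] obtain J where J: "finite J" "q = ?f ` J" by (elim exE conjE)
    have "finite (fst ` J)" using J(1) by simp
    then obtain N where N: "\<forall>i\<in>fst ` J. i < N" unfolding finite_nat_set_iff_bounded ..
    have "\<exists>x\<in>carrier grp. \<forall>i<N. \<exists>w\<in>sols (\<Gamma> i). x = w \<otimes>\<^bsub>grp\<^esub> c i 0"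
    proof (rule partial_products_in_cosets[OF normal cG])
      show "c i 0 \<in> sols (\<Gamma> l)" if "l \<noteq> i" for i l by (rule sols_othersD[OF c that])
    qed
    then obtain x where x: "x \<in> carrier grp" "\<forall>i<N. \<exists>w\<in>sols (\<Gamma> i). x = w \<otimes>\<^bsub>grp\<^esub> c i 0" ..
    have lx: "length x = n" "set x \<subseteq> univ C" using x(1) solsD unfolding carrier_grp by auto
    have holds: "holds C (\<phi> i, ?a i 0) x" "holds C (Neg (\<phi> i), ?a i 1) x" if i: "i \<in> fst ` J" for i
    proof -
      from x(2)[rule_format, OF bspec[OF N i]] obtain w where w: "w \<in> sols (\<Gamma> i)" "x = w \<otimes>\<^bsub>grp\<^esub> c i 0" ..
      have near: "near (Q i) x (c i 0)" unfolding w(2) by (rule near_mult[OF w(1) Q(2) cG])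
      have "holds C (\<phi> i, ?a i j) x = near (Q i) x (c i j)" for j
        using \<psi>(2)[OF lx(1) len, of i i j] by (simp add: holds_def \<phi>_def p_def)
      then show "holds C (\<phi> i, ?a i 0) x" "holds C (Neg (\<phi> i), ?a i 1) x"
        using near Q(3)[OF x(1) near] by (simp_all add: holds_def)
    qed
    have "holds C \<theta> x" if \<theta>: "\<theta> \<in> q" for \<theta>
    proof -
      obtain i b where ib: "(i, b) \<in> J" "\<theta> = ?f (i, b)" using \<theta> unfolding J(2) by (elim imageE) auto
      have "i \<in> fst ` J" by (rule image_eqI[OF _ ib(1)]) simp
      from holds[OF this] show ?thesis unfolding ib(2) by simp
    qed
    then have "x \<in> solutions C n q" unfolding solutions_def using lx by simp
    then show "solutions C n q \<noteq> {}" by auto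
  qed
  ultimately show ?thesis unfolding strongly_dependent_def not_not by (intro exI conjI) auto
qed

end

theorem proposition3p11:
  fixes L :: "('f, 'r) lang"
    and T :: "('f, 'r) fm set"
    and C :: "('f, 'r, 'a) struct"
    and \<kappa> :: "'k rel"
    and A :: "'a set"
    and n :: nat
    and \<Sigma> :: "('f, 'r, 'a) pfm set"
    and \<nu> :: "('f, 'r, 'a) pfm"
    and \<Gamma> :: "nat \<Rightarrow> ('f, 'r, 'a) pfm set"
  assumes "complete_theory L T"
    and "monster_model \<kappa> L T C"
    and "strongly_dependent L C"
    and "A \<subseteq> univ C" and "small \<kappa> A"
    and "type_definable_group L C A n \<Sigma> \<nu>"
    and "\<And>i. partial_type L A n (\<Gamma> i)"
    and "\<And>i. solutions C n (\<Gamma> i) \<lhd> td_group C n \<Sigma> \<nu>"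
  shows "\<exists>i0. bounded_index \<kappa> L C A n \<nu> (\<Union>i \<in> - {i0}. \<Gamma> i) (\<Union>i. \<Gamma> i)"
proof (rule ccontr)
  have monster: "strong_limit \<kappa>" "small \<kappa> {\<phi> :: ('f, 'r) fm. wf_fm L \<phi>}" "models L C T" "saturated \<kappa> L C"
    using assms(2) by (simp_all add: monster_model_def)
  have nonempty: "univ C \<noteq> {}" using monster(3) by (simp add: models_def is_struct_def)
  have nat: "small \<kappa> (UNIV :: nat set)"
    by (rule small_if_inj[OF monster(2), of "\<lambda>v. Eq (Var v) (Var v)"]) (auto simp: inj_on_def)
  interpret td_subgroups \<kappa> L C A n \<Sigma> \<nu> \<Gamma>
    by (intro td_subgroups.intro saturated_model.intro uncountable_strong_limit.intro
        saturated_model_axioms.intro td_subgroups_axioms.intro) (fact assms monster nonempty nat)+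
  assume "\<not> ?thesis"
  then have unb: "unbounded_index \<kappa> L C A n \<nu> (others i) (\<Union>i. \<Gamma> i)" for i by simp
  have "\<exists>Q b. finite Q \<and> Q \<subseteq> \<Gamma> i \<and> (\<forall>j :: nat. b j \<in> sols (others i)) \<and>
      (\<forall>j j'. j < j' \<longrightarrow> \<not> near Q (b j) (b j'))" for i
  proof -
    obtain Q where Q: "finite Q" "Q \<subseteq> \<Gamma> i"
      "\<not> (\<exists>F. finite F \<and> F \<subseteq> sols (others i) \<and> (\<forall>g\<in>sols (others i). \<exists>a\<in>F. near Q a g))"
      using bounded_if_translates_met[of i] unb[of i] by metis
    obtain b :: "nat \<Rightarrow> 'a list" where "\<And>j. b j \<in> sols (others i)" "\<And>j j'. j < j' \<Longrightarrow> \<not> near Q (b j) (b j')"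
      by (rule greedy_sequence[of "sols (others i)" "near Q"]) (use Q(3) in auto)
    then show ?thesis using Q(1,2) by (intro exI[of _ Q] exI[of _ b]) simp
  qed
  from choice[OF allI[OF this]] obtain Q where "\<forall>i. \<exists>b. finite (Q i) \<and> Q i \<subseteq> \<Gamma> i \<and>
      (\<forall>j :: nat. b j \<in> sols (others i)) \<and> (\<forall>j j'. j < j' \<longrightarrow> \<not> near (Q i) (b j) (b j'))" ..
  from choice[OF this] obtain b where "\<forall>i. finite (Q i) \<and> Q i \<subseteq> \<Gamma> i \<and>
      (\<forall>j :: nat. b i j \<in> sols (others i)) \<and> (\<forall>j j'. j < j' \<longrightarrow> \<not> near (Q i) (b i j) (b i j'))" ..
  then have Qb: "finite (Q i)" "Q i \<subseteq> \<Gamma> i" "b i j \<in> sols (others i)"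
    "j < j' \<Longrightarrow> \<not> near (Q i) (b i j) (b i j')" for i j j' by simp_all
  obtain c where "separating_array c"
    by (rule ex_separating_array[OF Qb(3) Qb(1,2,4)])
  then have "\<not> strongly_dependent L C" by (rule not_strongly_dependent)
  then show False using assms(3) by simp
qed

end
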